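(* Let $d,n\in\mathbb{N}$ and $\varepsilon\le\alpha\le 1$ (with $\varepsilon n$ an integer). Let $\mathcal{D}_0$ be the distribution of $n$ i.i.d. samples from $\mathcal{N}(0,I_d)$. For a parameter $\beta\ge 0$, let $\mathcal{D}_1=\mathcal{D}_1(\beta)$ be the distribution of $(X_1,\dots,X_n)$ generated as follows: (1) select a uniformly random subset $A\subset[n]$ of size $\varepsilon n$; (2) draw $\{X_i\}_{i\in A}$ i.i.d. from $\mathcal{N}(0,I_d)$ and set $\mathbf{R}_A=\sum_{i\in A}X_i$; (3) draw $z\sim\mathcal{N}(0,\frac{\alpha^2}{d}I_d)$; (4) set $\mu=-\beta\mathbf{R}_A-z$ and draw $\{X_i\}_{i\in[n]\setminus A}$ i.i.d. from $\mathcal{N}(\mu,I_d)$. There is a sufficiently small absolute constant $c>0$ such that the following holds: if $n\le c\cdot\min\left(\frac{d^{2/3}\varepsilon^{2/3}}{\alpha^{8/3}},\frac{d\varepsilon}{\alpha^2}\right)$ and $n\ge\frac{\sqrt d}{\alpha^2}+\frac{d\varepsilon^3}{\alpha^4}$, then for an appropriate choice of $\beta$ (depending on $\varepsilon,\alpha,d,n$) we have $d_{TV}(\mathcal{D}_0,\mathcal{D}_1)\le 0.1$.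
   Context: $d_{TV}$ denotes total variation distance. *)

theory Defs
  imports "HOL-Probability.Probability"
begin

text \<open>
  The constant of the theorem is uniform in the dimension, so vectors in dimension \<open>d\<close> are
  (extensional) functions on the index set \<open>{1..d}\<close>, and a tuple of \<open>n\<close> such vectors is an
  (extensional) function on \<open>{1..n}\<close>; \<open>X i j\<close> is the \<open>j\<close>-th coordinate of the \<open>i\<close>-th sample.
\<close>

abbreviation euclid :: "nat \<Rightarrow> (nat \<Rightarrow> real) measure" where
  "euclid d \<equiv> \<Pi>\<^sub>M j\<in>{1..d}. borel"

abbreviation samples :: "nat \<Rightarrow> nat \<Rightarrow> (nat \<Rightarrow> nat \<Rightarrow> real) measure" where
  "samples d n \<equiv> \<Pi>\<^sub>M i\<in>{1..n}. euclid d"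

text \<open>The second argument of \<open>normal_density\<close> is the standard deviation; here \<open>v\<close> is the
  variance, so that \<open>gaussian d m v\<close> is \<open>\<N>(m, v I\<^sub>d)\<close> for \<open>v > 0\<close>.\<close>

definition gaussian :: "nat \<Rightarrow> (nat \<Rightarrow> real) \<Rightarrow> real \<Rightarrow> (nat \<Rightarrow> real) measure" where
  "gaussian d m v = (\<Pi>\<^sub>M j\<in>{1..d}. density lborel (\<lambda>x. ennreal (normal_density (m j) (sqrt v) x)))"

definition null_dist :: "nat \<Rightarrow> nat \<Rightarrow> (nat \<Rightarrow> nat \<Rightarrow> real) measure" where
  "null_dist d n = (\<Pi>\<^sub>M i\<in>{1..n}. gaussian d (\<lambda>_. 0) 1)"

text \<open>\<open>alt_dist\<close> is only meaningful when \<open>\<epsilon> * n\<close> is an integer between 0 and \<open>n\<close>;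
  then \<open>nat \<lfloor>\<epsilon> * real n\<rfloor>\<close> is that integer.\<close>

definition alt_dist ::
    "nat \<Rightarrow> nat \<Rightarrow> real \<Rightarrow> real \<Rightarrow> real \<Rightarrow> (nat \<Rightarrow> nat \<Rightarrow> real) measure" where
  "alt_dist d n \<epsilon> \<alpha> \<beta> =
    do {
      A \<leftarrow> uniform_count_measure {A. A \<subseteq> {1..n} \<and> card A = nat \<lfloor>\<epsilon> * real n\<rfloor>};
      X \<leftarrow> (\<Pi>\<^sub>M i\<in>A. gaussian d (\<lambda>_. 0) 1);
      z \<leftarrow> gaussian d (\<lambda>_. 0) (\<alpha>\<^sup>2 / real d);
      Y \<leftarrow> (\<Pi>\<^sub>M i\<in>{1..n} - A. gaussian d (\<lambda>j. - \<beta> * (\<Sum>i\<in>A. X i j) - z j) 1);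
      return (samples d n) (merge A ({1..n} - A) (X, Y))
    }"

definition tv_dist :: "'a measure \<Rightarrow> 'a measure \<Rightarrow> real" where
  "tv_dist M N = (SUP E\<in>sets M. \<bar>measure M E - measure N E\<bar>)"

end

theory Submission
  imports Defs
begin

text \<open>
  Write \<open>k = \<epsilon> n\<close>, \<open>m = n - k\<close>, \<open>\<tau> = \<alpha>\<^sup>2 / d\<close>, and choose \<open>\<beta>\<close> as the smaller root of
  \<open>\<beta>\<^sup>2 k m + m \<tau> = 2 \<beta> k\<close>, which makes the variance of \<open>\<Sum>i. X i j\<close> the same under both hypotheses.
  The planted law of one coordinate, given \<open>A\<close>, is then that of a standard normal vector \<open>x\<close> translated by
  \<open>\<theta>\<close> times the centered indicator of \<open>A\<close>, where \<open>\<theta> = - \<beta> (\<Sum>i. x i) - z\<close> for an independent centered normal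
  \<open>z\<close> of variance \<open>n \<tau> / k\<close>. The translation preserves \<open>\<Sum>i. x i\<close>, so for two sets \<open>A\<close>, \<open>A'\<close> with
  \<open>s = card (A \<inter> A') - k\<^sup>2 / n\<close> the Cameron--Martin formula gives, with \<open>\<theta>'\<close> built from another copy of \<open>z\<close>,
  \<open>E\<^sub>0 [L\<^sub>A L\<^sub>A'] = (E exp (s \<theta> \<theta>')) ^ d = ((1 - \<beta>\<^sup>2 n s)\<^sup>2 - (2 \<beta> n s / m)\<^sup>2) powr (- d / 2)\<close>,
  which is at most \<open>exp (d \<beta>\<^sup>2 n s + 9 d \<beta>\<^sup>2 s\<^sup>2)\<close>. The centered hypergeometric variable \<open>s\<close> is
  sub-Poissonian with variance proxy \<open>V = k\<^sup>2 / n\<close>. The bounds on \<open>n\<close> make \<open>V\<close>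
  large and \<open>d \<beta>\<^sup>2 n\<close> and \<open>d \<beta>\<^sup>2 k\<close> small compared with \<open>1 / sqrt V\<close>, so that the chi-square divergence is at most
  \<open>0.01\<close> and the total variation distance at most \<open>0.1\<close>.
\<close>

section \<open>Densities on products and mixtures\<close>

lemma PiM_density:
  assumes I: "finite I" and M: "\<And>i. sigma_finite_measure (M i)"
    and f [measurable]: "\<And>i. f i \<in> borel_measurable (M i)"
    and dens: "\<And>i. sigma_finite_measure (density (M i) (f i))"
  shows "(\<Pi>\<^sub>M i\<in>I. density (M i) (f i)) = density (\<Pi>\<^sub>M i\<in>I. M i) (\<lambda>x. \<Prod>i\<in>I. f i (x i))"
proof -
  interpret D: product_sigma_finite "\<lambda>i. density (M i) (f i)"
    by (rule product_sigma_finite.intro) (rule dens)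
  interpret M: product_sigma_finite M
    by (rule product_sigma_finite.intro) (rule M)
  have "density (PiM I M) (\<lambda>x. \<Prod>i\<in>I. f i (x i)) = PiM I (\<lambda>i. density (M i) (f i))"
  proof (rule D.PiM_eqI[OF I])
    show "sets (density (PiM I M) (\<lambda>x. \<Prod>i\<in>I. f i (x i))) = sets (PiM I (\<lambda>i. density (M i) (f i)))"
      by (simp cong: sets_PiM_cong)
    fix A assume "\<And>i. i \<in> I \<Longrightarrow> A i \<in> sets (density (M i) (f i))"
    then have A [measurable]: "\<And>i. i \<in> I \<Longrightarrow> A i \<in> sets (M i)" by simp
    have [measurable]: "Pi\<^sub>E I A \<in> sets (PiM I M)"
      using A I by (intro sets_PiM_I_finite) auto
    have "emeasure (density (PiM I M) (\<lambda>x. \<Prod>i\<in>I. f i (x i))) (Pi\<^sub>E I A)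
        = (\<integral>\<^sup>+x. (\<Prod>i\<in>I. f i (x i)) * indicator (Pi\<^sub>E I A) x \<partial>PiM I M)"
      by (rule emeasure_density) measurable
    also have "\<dots> = (\<integral>\<^sup>+x. (\<Prod>i\<in>I. f i (x i) * indicator (A i) (x i)) \<partial>PiM I M)"
    proof (rule nn_integral_cong)
      fix x assume "x \<in> space (PiM I M)"
      then have "indicator (Pi\<^sub>E I A) x = (\<Prod>i\<in>I. indicator (A i) (x i) :: ennreal)"
        using I by (auto simp: indicator_def space_PiM PiE_iff)
      then show "(\<Prod>i\<in>I. f i (x i)) * indicator (Pi\<^sub>E I A) x = (\<Prod>i\<in>I. f i (x i) * indicator (A i) (x i))"
        by (simp add: prod.distrib)
    qed
    also have "\<dots> = (\<Prod>i\<in>I. \<integral>\<^sup>+x. f i x * indicator (A i) x \<partial>M i)"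
      using I by (intro M.product_nn_integral_prod) auto
    also have "\<dots> = (\<Prod>i\<in>I. emeasure (density (M i) (f i)) (A i))"
      using A by (intro prod.cong) (auto simp: emeasure_density)
    finally show "emeasure (density (PiM I M) (\<lambda>x. \<Prod>i\<in>I. f i (x i))) (Pi\<^sub>E I A)
        = (\<Prod>i\<in>I. emeasure (density (M i) (f i)) (A i))" .
  qed
  then show ?thesis ..
qed

lemma measurable_PiM_component2:
  assumes "i \<in> I" "j \<in> J"
  shows "(\<lambda>x. x i j) \<in> (\<Pi>\<^sub>M i\<in>I. \<Pi>\<^sub>M j\<in>J. N) \<rightarrow>\<^sub>M N"
  using assms by (auto intro: measurable_compose[of "\<lambda>x. x i" _ "\<Pi>\<^sub>M j\<in>J. N"])

lemma measurable_PiM_column: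
  "j \<in> J \<Longrightarrow> (\<lambda>x. \<lambda>i\<in>I. x i j) \<in> (\<Pi>\<^sub>M i\<in>I. \<Pi>\<^sub>M j\<in>J. N) \<rightarrow>\<^sub>M (\<Pi>\<^sub>M i\<in>I. N)"
  by (intro measurable_restrict measurable_PiM_component2)

lemma measurable_nn_integral_PiM_fun_upd:
  assumes PI: "sigma_finite_measure (PiM I M)" and f: "f \<in> borel_measurable (PiM (insert i I) M)"
  shows "(\<lambda>z. \<integral>\<^sup>+x. f (x(i := z)) \<partial>PiM I M) \<in> borel_measurable (M i)"
proof (rule sigma_finite_measure.borel_measurable_nn_integral[OF PI])
  have "(\<lambda>p. (snd p)(i := fst p)) \<in> M i \<Otimes>\<^sub>M PiM I M \<rightarrow>\<^sub>M PiM (insert i I) M"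
    by (intro measurable_fun_upd[where J=I]) auto
  from measurable_compose[OF this f] show "(\<lambda>(z, x). f (x(i := z))) \<in> borel_measurable (M i \<Otimes>\<^sub>M PiM I M)"
    by (simp only: split_beta')
qed

lemma nn_integral_PiM_prod_columns:
  assumes N: "prob_space N" and I: "finite I" and J: "finite J"
    and "\<And>j. j \<in> J \<Longrightarrow> \<phi> j \<in> borel_measurable (\<Pi>\<^sub>M i\<in>I. N)"
  shows "(\<integral>\<^sup>+x. (\<Prod>j\<in>J. \<phi> j (\<lambda>i\<in>I. x i j)) \<partial>(\<Pi>\<^sub>M i\<in>I. \<Pi>\<^sub>M j\<in>J. N)) = (\<Prod>j\<in>J. \<integral>\<^sup>+x. \<phi> j x \<partial>(\<Pi>\<^sub>M i\<in>I. N))"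
proof -
  interpret N: product_prob_space "\<lambda>_. N" UNIV
    by (intro product_prob_spaceI N)
  interpret PN: product_prob_space "\<lambda>_. \<Pi>\<^sub>M j\<in>J. N" UNIV
    by (intro product_prob_spaceI prob_space_PiM N)
  show ?thesis
    using I assms(4)
  proof (induction I arbitrary: \<phi> rule: finite_induct)
    case empty
    show ?case by (simp only: N.nn_integral_empty PN.nn_integral_empty zero_le) (simp add: restrict_def)
  next
    case (insert i I)
    interpret PI: prob_space "\<Pi>\<^sub>M i\<in>I. N"
      by (intro prob_space_PiM N)
    note [measurable] = insert.prems measurable_PiM_column
    have upd: "(\<lambda>k\<in>insert i I. (x(i := y)) k j) = (\<lambda>k\<in>I. x k j)(i := y j)" for x y j
      using insert.hyps by (auto simp: fun_eq_iff)
    have "(\<integral>\<^sup>+x. (\<Prod>j\<in>J. \<phi> j (\<lambda>k\<in>insert i I. x k j)) \<partial>(\<Pi>\<^sub>M i\<in>insert i I. \<Pi>\<^sub>M j\<in>J. N))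
        = (\<integral>\<^sup>+y. \<integral>\<^sup>+x. (\<Prod>j\<in>J. \<phi> j ((\<lambda>k\<in>I. x k j)(i := y j))) \<partial>(\<Pi>\<^sub>M i\<in>I. \<Pi>\<^sub>M j\<in>J. N) \<partial>(\<Pi>\<^sub>M j\<in>J. N))"
      using insert.hyps by (subst PN.product_nn_integral_insert_rev) (simp_all only: upd, measurable)
    also have "\<dots> = (\<integral>\<^sup>+y. (\<Prod>j\<in>J. \<integral>\<^sup>+x. \<phi> j (x(i := y j)) \<partial>(\<Pi>\<^sub>M i\<in>I. N)) \<partial>(\<Pi>\<^sub>M j\<in>J. N))"
    proof (rule nn_integral_cong, rule insert.IH)
      fix y j assume "y \<in> space (\<Pi>\<^sub>M j\<in>J. N)" "j \<in> J"
      then have "(\<lambda>x. x(i := y j)) \<in> (\<Pi>\<^sub>M i\<in>I. N) \<rightarrow>\<^sub>M (\<Pi>\<^sub>M i\<in>insert i I. N)"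
        by (intro measurable_fun_upd[where J=I] measurable_const) (auto simp: space_PiM PiE_iff)
      then show "(\<lambda>x. \<phi> j (x(i := y j))) \<in> borel_measurable (\<Pi>\<^sub>M i\<in>I. N)"
        by (rule measurable_compose) (rule insert.prems[OF \<open>j \<in> J\<close>])
    qed
    also have "\<dots> = (\<Prod>j\<in>J. \<integral>\<^sup>+z. \<integral>\<^sup>+x. \<phi> j (x(i := z)) \<partial>(\<Pi>\<^sub>M i\<in>I. N) \<partial>N)"
      using insert.prems PI.sigma_finite_measure_axioms
      by (intro N.product_nn_integral_prod[OF J] measurable_nn_integral_PiM_fun_upd)
    also have "\<dots> = (\<Prod>j\<in>J. \<integral>\<^sup>+x. \<phi> j x \<partial>(\<Pi>\<^sub>M i\<in>insert i I. N))"
      using insert by (intro prod.cong refl N.product_nn_integral_insert_rev[symmetric]) auto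
    finally show ?case .
  qed
qed

lemma nn_integral_swap_triple:
  assumes M: "sigma_finite_measure M" and N: "sigma_finite_measure N"
    and f [measurable]: "(\<lambda>(x, z, z'). f x z z') \<in> borel_measurable (M \<Otimes>\<^sub>M N \<Otimes>\<^sub>M N)"
  shows "(\<integral>\<^sup>+x. \<integral>\<^sup>+z. \<integral>\<^sup>+z'. f x z z' \<partial>N \<partial>N \<partial>M) = (\<integral>\<^sup>+z. \<integral>\<^sup>+z'. \<integral>\<^sup>+x. f x z z' \<partial>M \<partial>N \<partial>N)"
proof -
  interpret M: sigma_finite_measure M by fact
  interpret N: sigma_finite_measure N by fact
  interpret MN: pair_sigma_finite M N ..
  have [measurable]: "(\<lambda>p. f (fst (fst p)) (snd (fst p)) (snd p)) \<in> borel_measurable ((M \<Otimes>\<^sub>M N) \<Otimes>\<^sub>M N)"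
  proof -
    have "(\<lambda>p. (fst (fst p), snd (fst p), snd p)) \<in> (M \<Otimes>\<^sub>M N) \<Otimes>\<^sub>M N \<rightarrow>\<^sub>M M \<Otimes>\<^sub>M N \<Otimes>\<^sub>M N" by measurable
    from measurable_compose[OF this f] show ?thesis by simp
  qed
  have "(\<integral>\<^sup>+x. \<integral>\<^sup>+z. \<integral>\<^sup>+z'. f x z z' \<partial>N \<partial>N \<partial>M) = (\<integral>\<^sup>+z. \<integral>\<^sup>+x. \<integral>\<^sup>+z'. f x z z' \<partial>N \<partial>M \<partial>N)"
    by (rule MN.Fubini'[symmetric]) measurable
  also have "\<dots> = (\<integral>\<^sup>+z. \<integral>\<^sup>+z'. \<integral>\<^sup>+x. f x z z' \<partial>M \<partial>N \<partial>N)"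
  proof (intro nn_integral_cong MN.Fubini'[symmetric])
    fix z assume "z \<in> space N"
    then have "(\<lambda>p. (fst p, z, snd p)) \<in> M \<Otimes>\<^sub>M N \<rightarrow>\<^sub>M M \<Otimes>\<^sub>M N \<Otimes>\<^sub>M N" by measurable
    from measurable_compose[OF this f] show "(\<lambda>(x, z'). f x z z') \<in> borel_measurable (M \<Otimes>\<^sub>M N)"
      by (simp add: split_beta')
  qed
  finally show ?thesis .
qed

lemma measurable_density_kernel:
  assumes N: "sigma_finite_measure N"
    and w [measurable]: "(\<lambda>(x, y). w x y) \<in> borel_measurable (M \<Otimes>\<^sub>M N)"
    and prob: "\<And>x. x \<in> space M \<Longrightarrow> prob_space (density N (w x))"
  shows "(\<lambda>x. density N (w x)) \<in> M \<rightarrow>\<^sub>M prob_algebra N"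
proof (rule measurable_prob_algebraI, rule prob, assumption, rule measurable_subprob_algebra)
  interpret N: sigma_finite_measure N by fact
  fix E assume [measurable]: "E \<in> sets N"
  have "(\<lambda>x. \<integral>\<^sup>+y. w x y * indicator E y \<partial>N) \<in> borel_measurable M"
    by measurable
  then show "(\<lambda>x. emeasure (density N (w x)) E) \<in> borel_measurable M"
    by (rule measurable_cong[THEN iffD1, rotated]) (simp add: emeasure_density)
qed (auto intro: prob_space_imp_subprob_space prob)

lemma bind_density:
  assumes M: "prob_space M" and N: "sigma_finite_measure N"
    and w [measurable]: "(\<lambda>(x, y). w x y) \<in> borel_measurable (M \<Otimes>\<^sub>M N)"
    and prob: "\<And>x. x \<in> space M \<Longrightarrow> prob_space (density N (w x))"
  shows "M \<bind> (\<lambda>x. density N (w x)) = density N (\<lambda>y. \<integral>\<^sup>+x. w x y \<partial>M)"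
proof (rule measure_eqI)
  interpret M: prob_space M by fact
  interpret N: sigma_finite_measure N by fact
  interpret MN: pair_sigma_finite M N ..
  have kernel: "(\<lambda>x. density N (w x)) \<in> M \<rightarrow>\<^sub>M subprob_algebra N"
    using measurable_density_kernel[OF N w prob] by (rule measurable_prob_algebraD)
  show sets: "sets (M \<bind> (\<lambda>x. density N (w x))) = sets (density N (\<lambda>y. \<integral>\<^sup>+x. w x y \<partial>M))"
    using sets_bind_measurable[OF kernel M.not_empty] by simp
  fix E assume "E \<in> sets (M \<bind> (\<lambda>x. density N (w x)))"
  then have E [measurable]: "E \<in> sets N" by (simp add: sets)
  have "emeasure (M \<bind> (\<lambda>x. density N (w x))) E = (\<integral>\<^sup>+x. emeasure (density N (w x)) E \<partial>M)"
    by (rule emeasure_bind[OF M.not_empty kernel E])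
  also have "\<dots> = (\<integral>\<^sup>+x. \<integral>\<^sup>+y. w x y * indicator E y \<partial>N \<partial>M)"
    by (intro nn_integral_cong emeasure_density) measurable
  also have "\<dots> = (\<integral>\<^sup>+y. \<integral>\<^sup>+x. w x y * indicator E y \<partial>M \<partial>N)"
    by (rule MN.Fubini'[symmetric]) measurable
  also have "\<dots> = (\<integral>\<^sup>+y. (\<integral>\<^sup>+x. w x y \<partial>M) * indicator E y \<partial>N)"
    by (intro nn_integral_cong nn_integral_multc) measurable
  also have "\<dots> = emeasure (density N (\<lambda>y. \<integral>\<^sup>+x. w x y \<partial>M)) E"
    by (rule emeasure_density[symmetric]) measurable
  finally show "emeasure (M \<bind> (\<lambda>x. density N (w x))) E = emeasure (density N (\<lambda>y. \<integral>\<^sup>+x. w x y \<partial>M)) E" .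
qed

lemma bind_density_return_merge:
  assumes M: "\<And>i. prob_space (M i)" and AB: "A \<inter> B = {}" "finite A" "finite B"
    and L [measurable]: "L \<in> borel_measurable (PiM (A \<union> B) M)"
    and prob: "\<And>x. x \<in> space (PiM A M) \<Longrightarrow> prob_space (density (PiM B M) (\<lambda>y. L (merge A B (x, y))))"
  shows "PiM A M \<bind> (\<lambda>x. density (PiM B M) (\<lambda>y. L (merge A B (x, y))) \<bind> (\<lambda>y. return (PiM (A \<union> B) M) (merge A B (x, y))))
    = density (PiM (A \<union> B) M) L" (is "?lhs = ?rhs")
proof (rule measure_eqI)
  let ?A = "PiM A M" and ?B = "PiM B M" and ?AB = "PiM (A \<union> B) M"
  interpret M: product_prob_space M UNIV by (intro product_prob_spaceI M)
  interpret PA: prob_space ?A by (intro prob_space_PiM M)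
  interpret PB: prob_space ?B by (intro prob_space_PiM M)
  define K where "K x = density ?B (\<lambda>y. L (merge A B (x, y))) \<bind> (\<lambda>y. return ?AB (merge A B (x, y)))" for x
  have "(\<lambda>x. density ?B (\<lambda>y. L (merge A B (x, y)))) \<in> ?A \<rightarrow>\<^sub>M prob_algebra ?B"
    using prob by (intro measurable_density_kernel PB.sigma_finite_measure_axioms) auto
  then have "K \<in> ?A \<rightarrow>\<^sub>M prob_algebra ?AB"
    unfolding K_def by measurable
  then have kernel: "K \<in> ?A \<rightarrow>\<^sub>M subprob_algebra ?AB" by (rule measurable_prob_algebraD)
  show sets: "sets ?lhs = sets ?rhs"
    unfolding K_def[symmetric] sets_density by (rule sets_bind_measurable[OF kernel PA.not_empty])
  fix E assume "E \<in> sets ?lhs"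
  then have E [measurable]: "E \<in> sets ?AB" by (simp add: sets)
  have emeasure_K: "emeasure (K x) E = (\<integral>\<^sup>+y. L (merge A B (x, y)) * indicator E (merge A B (x, y)) \<partial>?B)"
    if x: "x \<in> space ?A" for x
  proof -
    have [measurable]: "(\<lambda>y. merge A B (x, y)) \<in> ?B \<rightarrow>\<^sub>M ?AB"
      using measurable_compose[OF measurable_Pair1'[OF x] measurable_merge] .
    have "K x = distr (density ?B (\<lambda>y. L (merge A B (x, y)))) ?AB (\<lambda>y. merge A B (x, y))"
      unfolding K_def using prob_space.not_empty[OF prob[OF x]] by (intro bind_return_distr') simp_all
    then have "emeasure (K x) E = (\<integral>\<^sup>+y. indicator E (merge A B (x, y)) \<partial>density ?B (\<lambda>y. L (merge A B (x, y))))"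
      by (simp add: nn_integral_distr flip: nn_integral_indicator)
    then show ?thesis by (simp add: nn_integral_density)
  qed
  have "emeasure ?lhs E = (\<integral>\<^sup>+x. emeasure (K x) E \<partial>?A)"
    unfolding K_def[symmetric] by (rule emeasure_bind[OF PA.not_empty kernel E])
  also have "\<dots> = (\<integral>\<^sup>+x. \<integral>\<^sup>+y. L (merge A B (x, y)) * indicator E (merge A B (x, y)) \<partial>?B \<partial>?A)"
    by (intro nn_integral_cong emeasure_K)
  also have "\<dots> = (\<integral>\<^sup>+x. L x * indicator E x \<partial>?AB)"
    by (rule M.product_nn_integral_fold[OF AB, symmetric]) measurable
  also have "\<dots> = emeasure ?rhs E"
    by (rule emeasure_density[symmetric]) measurable
  finally show "emeasure ?lhs E = emeasure ?rhs E" .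
qed

lemma prob_space_density_PiM_Un:
  assumes M: "\<And>i. prob_space (M i)" and AB: "A \<inter> B = {}" "finite A" "finite B"
    and L [measurable]: "L \<in> borel_measurable (PiM (A \<union> B) M)"
    and prob: "\<And>x. x \<in> space (PiM A M) \<Longrightarrow> prob_space (density (PiM B M) (\<lambda>y. L (merge A B (x, y))))"
  shows "prob_space (density (PiM (A \<union> B) M) L)"
proof (rule prob_spaceI)
  interpret M: product_prob_space M UNIV by (intro product_prob_spaceI M)
  interpret PA: prob_space "PiM A M" by (intro prob_space_PiM M)
  have slice: "(\<integral>\<^sup>+y. L (merge A B (x, y)) \<partial>PiM B M) = 1" if x: "x \<in> space (PiM A M)" for x
  proof -
    have [measurable]: "(\<lambda>y. merge A B (x, y)) \<in> PiM B M \<rightarrow>\<^sub>M PiM (A \<union> B) M"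
      using measurable_compose[OF measurable_Pair1'[OF x] measurable_merge] .
    show ?thesis
      using prob_space.emeasure_space_1[OF prob[OF x]] by (simp add: emeasure_density cong: nn_integral_cong)
  qed
  have "(\<integral>\<^sup>+x. L x \<partial>PiM (A \<union> B) M) = (\<integral>\<^sup>+x. \<integral>\<^sup>+y. L (merge A B (x, y)) \<partial>PiM B M \<partial>PiM A M)"
    by (rule M.product_nn_integral_fold[OF AB L])
  also have "\<dots> = 1"
    by (simp add: slice PA.emeasure_space_1 cong: nn_integral_cong)
  finally show "emeasure (density (PiM (A \<union> B) M) L) (space (density (PiM (A \<union> B) M) L)) = 1"
    by (simp add: emeasure_density cong: nn_integral_cong)
qed

section \<open>Normal distributions\<close>

definition normal_measure :: "real \<Rightarrow> real \<Rightarrow> real measure" where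
  "normal_measure m v = density lborel (\<lambda>x. ennreal (normal_density m (sqrt v) x))"

abbreviation std_normal_prod :: "'i set \<Rightarrow> ('i \<Rightarrow> real) measure" where
  "std_normal_prod I \<equiv> \<Pi>\<^sub>M i\<in>I. normal_measure 0 1"

lemma space_normal_measure [simp]: "space (normal_measure m v) = UNIV"
  by (simp add: normal_measure_def)

lemma sets_normal_measure [simp, measurable_cong]: "sets (normal_measure m v) = sets borel"
  by (simp add: normal_measure_def)

lemma prob_space_normal_measure: "v > 0 \<Longrightarrow> prob_space (normal_measure m v)"
  unfolding normal_measure_def by (rule prob_space_normal_density) simp

lemma nn_integral_normal_measure:
  assumes "f \<in> borel_measurable borel"
  shows "(\<integral>\<^sup>+x. f x \<partial>normal_measure m v) = (\<integral>\<^sup>+x. ennreal (normal_density m (sqrt v) x) * f x \<partial>lborel)"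
  unfolding normal_measure_def using assms by (intro nn_integral_density) auto

interpretation std_normal: prob_space "normal_measure 0 1"
  by (rule prob_space_normal_measure) simp

interpretation std_normal_prod: product_prob_space "\<lambda>_. normal_measure 0 1" UNIV
  by (intro product_prob_spaceI std_normal.prob_space_axioms)

interpretation lborel_prod: product_sigma_finite "\<lambda>_. lborel :: real measure"
  by standard

lemma prob_space_std_normal_prod: "prob_space (std_normal_prod I)"
  by (intro prob_space_PiM std_normal.prob_space_axioms)

lemma nn_integral_normal_exp_quadratic:
  fixes B C :: real
  assumes v: "v > 0" and C: "v * C < 1"
  shows "(\<integral>\<^sup>+x. ennreal (exp (C * x\<^sup>2 / 2 + B * x)) \<partial>normal_measure 0 v)
    = ennreal (exp (v * B\<^sup>2 / (2 * (1 - v * C))) / sqrt (1 - v * C))"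
proof -
  define r where "r = 1 - v * C"
  have r: "r > 0" using C by (simp add: r_def)
  have "normal_density 0 (sqrt v) x * exp (C * x\<^sup>2 / 2 + B * x)
      = exp (v * B\<^sup>2 / (2 * r)) / sqrt r * normal_density (v * B / r) (sqrt (v / r)) x" for x
  proof -
    have C_eq: "C = (1 - r) / v" using v by (simp add: r_def)
    have "- x\<^sup>2 / (2 * v) + (C * x\<^sup>2 / 2 + B * x)
        = v * B\<^sup>2 / (2 * r) - (x - v * B / r)\<^sup>2 / (2 * (v / r))"
      unfolding C_eq using v r by (simp add: field_simps power2_eq_square)
    then show ?thesis
      using v r by (simp add: normal_density_def real_sqrt_mult real_sqrt_divide power_divide flip: exp_add)
  qed
  then have "(\<integral>\<^sup>+x. ennreal (exp (C * x\<^sup>2 / 2 + B * x)) \<partial>normal_measure 0 v)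
      = (\<integral>\<^sup>+x. ennreal (exp (v * B\<^sup>2 / (2 * r)) / sqrt r)
          * ennreal (normal_density (v * B / r) (sqrt (v / r)) x) \<partial>lborel)"
    using r by (simp add: nn_integral_normal_measure flip: ennreal_mult)
  also have "\<dots> = ennreal (exp (v * B\<^sup>2 / (2 * r)) / sqrt r)"
    using v r by (simp add: nn_integral_cmult nn_integral_eq_integral)
  finally show ?thesis by (simp add: r_def)
qed

lemma density_std_normal_exp_shift:
  "density (normal_measure 0 1) (\<lambda>x. ennreal (exp (\<mu> * x - \<mu>\<^sup>2 / 2))) = normal_measure \<mu> 1"
proof -
  have "normal_density 0 1 x * exp (\<mu> * x - \<mu>\<^sup>2 / 2) = normal_density \<mu> 1 x" for x
    by (simp add: normal_density_def power2_eq_square field_simps flip: exp_add)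
  then show ?thesis
    unfolding normal_measure_def by (subst density_density_eq) (auto simp flip: ennreal_mult)
qed

lemma distr_sum_PiM_normal_measure:
  assumes I: "finite I" "I \<noteq> {}" and v: "\<And>i. i \<in> I \<Longrightarrow> v i > 0"
  shows "distr (\<Pi>\<^sub>M i\<in>I. normal_measure (m i) (v i)) borel (\<lambda>x. \<Sum>i\<in>I. x i) = normal_measure (\<Sum>i\<in>I. m i) (\<Sum>i\<in>I. v i)"
proof -
  define P where "P = (\<Pi>\<^sub>M i\<in>I. normal_measure (m i) (v i))"
  have component: "distr P (normal_measure (m i) (v i)) (\<lambda>x. x i) = normal_measure (m i) (v i)" if "i \<in> I" for i
    unfolding P_def using that v by (intro distr_PiM_component prob_space_normal_measure)
  interpret P: prob_space P
    unfolding P_def using v by (intro prob_space_PiM prob_space_normal_measure)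
  have restrict: "distr P P (\<lambda>x. restrict x I) = P"
  proof -
    have "distr P P (\<lambda>x. restrict x I) = distr P P (\<lambda>x. x)"
      by (intro distr_cong refl) (auto simp: P_def space_PiM PiE_restrict)
    then show ?thesis by simp
  qed
  have "P.indep_vars (\<lambda>i. normal_measure (m i) (v i)) (\<lambda>i x. x i) I"
    using I restrict component
    by (subst P.indep_vars_iff_distr_eq_PiM') (auto simp: P_def cong: PiM_cong)
  then have "P.indep_vars (\<lambda>_. borel) (\<lambda>i x. x i) I"
    by (rule P.indep_vars_compose2) auto
  moreover have "distributed P lborel (\<lambda>x. x i) (normal_density (m i) (sqrt (v i)))" if "i \<in> I" for i
    using component[OF that] that unfolding distributed_def
    by (auto simp: P_def normal_measure_def cong: distr_cong)
  ultimately have "distributed P lborel (\<lambda>x. \<Sum>i\<in>I. x i)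
      (normal_density (\<Sum>i\<in>I. m i) (sqrt (\<Sum>i\<in>I. (sqrt (v i))\<^sup>2)))"
    using I v by (intro P.sum_indep_normal) auto
  moreover have "(\<Sum>i\<in>I. (sqrt (v i))\<^sup>2) = (\<Sum>i\<in>I. v i)"
    using v by (intro sum.cong) (auto intro: less_imp_le)
  ultimately show ?thesis
    by (simp add: distributed_def P_def normal_measure_def cong: distr_cong)
qed

lemma nn_integral_sum_std_normal_prod:
  assumes I: "finite I" "I \<noteq> {}" and f: "f \<in> borel_measurable borel"
  shows "(\<integral>\<^sup>+x. f (\<Sum>i\<in>I. x i) \<partial>std_normal_prod I) = (\<integral>\<^sup>+t. f t \<partial>normal_measure 0 (real (card I)))"
proof -
  have law: "normal_measure 0 (real (card I)) = distr (std_normal_prod I) borel (\<lambda>x. \<Sum>i\<in>I. x i)"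
    using distr_sum_PiM_normal_measure[OF I, of "\<lambda>_. 1" "\<lambda>_. 0"] by simp
  show ?thesis unfolding law using f by (intro nn_integral_distr[symmetric]) auto
qed

lemma nn_integral_std_normal_prod:
  assumes I: "finite I" and F [measurable]: "F \<in> borel_measurable (\<Pi>\<^sub>M i\<in>I. borel)"
  shows "(\<integral>\<^sup>+x. F x \<partial>std_normal_prod I)
    = (\<integral>\<^sup>+x. ennreal (\<Prod>i\<in>I. normal_density 0 1 (x i)) * F x \<partial>(\<Pi>\<^sub>M i\<in>I. lborel))"
proof -
  have [measurable]: "F \<in> borel_measurable (\<Pi>\<^sub>M i\<in>I. lborel)"
    using F by (simp cong: measurable_cong_sets sets_PiM_cong)
  have "std_normal_prod I
      = density (\<Pi>\<^sub>M i\<in>I. lborel) (\<lambda>x. \<Prod>i\<in>I. ennreal (normal_density 0 1 (x i)))"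
    unfolding normal_measure_def real_sqrt_one
    using prob_space_imp_sigma_finite[OF prob_space_normal_density[of 1 0]]
    by (intro PiM_density I sigma_finite_lborel) auto
  then show ?thesis
    by (simp add: nn_integral_density prod_ennreal)
qed

section \<open>Shears of Lebesgue measure and Gaussian tilting\<close>

lemma nn_integral_PiM_lborel_translate:
  fixes F :: "('i \<Rightarrow> real) \<Rightarrow> ennreal"
  assumes "finite I" and "F \<in> borel_measurable (\<Pi>\<^sub>M i\<in>I. lborel)"
  shows "(\<integral>\<^sup>+x. F (\<lambda>i\<in>I. x i + a i) \<partial>(\<Pi>\<^sub>M i\<in>I. lborel)) = (\<integral>\<^sup>+x. F x \<partial>(\<Pi>\<^sub>M i\<in>I. lborel))"
  using assms
proof (induction I arbitrary: F rule: finite_induct)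
  case empty
  show ?case by (subst (1 2) lborel_prod.nn_integral_empty) (simp_all add: restrict_def)
next
  case (insert i I)
  note [measurable] = insert.prems
  let ?M = "\<lambda>I. \<Pi>\<^sub>M i\<in>I. lborel :: real measure"
  have upd: "(\<lambda>j\<in>insert i I. (x(i := y)) j + a j) = (\<lambda>j\<in>I. x j + a j)(i := a i + y)" for x y
    using insert.hyps by (auto simp: fun_eq_iff)
  have [measurable]: "(\<lambda>(x, y). x(i := y)) \<in> ?M I \<Otimes>\<^sub>M lborel \<rightarrow>\<^sub>M ?M (insert i I)"
    by measurable
  have "(\<integral>\<^sup>+x. F (\<lambda>j\<in>insert i I. x j + a j) \<partial>?M (insert i I))
      = (\<integral>\<^sup>+x. \<integral>\<^sup>+y. F ((\<lambda>j\<in>I. x j + a j)(i := a i + y)) \<partial>lborel \<partial>?M I)"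
    using insert.hyps by (subst lborel_prod.product_nn_integral_insert) (simp_all only: upd, measurable)
  also have "\<dots> = (\<integral>\<^sup>+x. \<integral>\<^sup>+y. F ((\<lambda>j\<in>I. x j + a j)(i := y)) \<partial>lborel \<partial>?M I)"
  proof (rule nn_integral_cong)
    fix x
    have [measurable]: "(\<lambda>y. (\<lambda>j\<in>I. x j + a j)(i := y)) \<in> lborel \<rightarrow>\<^sub>M ?M (insert i I)"
      by (rule measurable_fun_upd[where J=I]) (auto simp: space_PiM)
    show "(\<integral>\<^sup>+y. F ((\<lambda>j\<in>I. x j + a j)(i := a i + y)) \<partial>lborel)
        = (\<integral>\<^sup>+y. F ((\<lambda>j\<in>I. x j + a j)(i := y)) \<partial>lborel)"
      by (subst (2) nn_integral_real_affine[of _ 1 "a i"]) auto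
  qed
  also have "\<dots> = (\<integral>\<^sup>+x. \<integral>\<^sup>+y. F (x(i := y)) \<partial>lborel \<partial>?M I)"
    by (rule insert.IH) measurable
  also have "\<dots> = (\<integral>\<^sup>+x. F x \<partial>?M (insert i I))"
    using insert.hyps by (intro lborel_prod.product_nn_integral_insert[symmetric]) auto
  finally show ?case .
qed

lemma nn_integral_PiM_lborel_linear_form:
  fixes G :: "('i \<Rightarrow> real) \<Rightarrow> ennreal"
  assumes J: "finite J" "i\<^sub>0 \<notin> J" and e: "e i\<^sub>0 \<noteq> 0"
    and G [measurable]: "G \<in> borel_measurable (\<Pi>\<^sub>M i\<in>insert i\<^sub>0 J. lborel)"
  shows "(\<integral>\<^sup>+x. G x \<partial>(\<Pi>\<^sub>M i\<in>insert i\<^sub>0 J. lborel))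
    = ennreal \<bar>1 / e i\<^sub>0\<bar> *
      (\<integral>\<^sup>+t. \<integral>\<^sup>+x. G (x(i\<^sub>0 := (t - (\<Sum>i\<in>J. e i * x i)) / e i\<^sub>0)) \<partial>(\<Pi>\<^sub>M i\<in>J. lborel) \<partial>lborel)"
proof -
  let ?M = "\<lambda>I. \<Pi>\<^sub>M i\<in>I. lborel :: real measure"
  interpret MJ: pair_sigma_finite "?M J" lborel
    using lborel_prod.sigma_finite[OF J(1)] by (simp add: pair_sigma_finite_def sigma_finite_lborel)
  define lift where "lift t x = x(i\<^sub>0 := (t - (\<Sum>i\<in>J. e i * x i)) / e i\<^sub>0)" for t and x :: "'i \<Rightarrow> real"
  have [measurable]: "(\<lambda>(x, t). lift t x) \<in> ?M J \<Otimes>\<^sub>M lborel \<rightarrow>\<^sub>M ?M (insert i\<^sub>0 J)"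
    unfolding lift_def split_beta' by (intro measurable_fun_upd[where J=J]) auto
  have "(\<integral>\<^sup>+x. G x \<partial>?M (insert i\<^sub>0 J)) = (\<integral>\<^sup>+x. \<integral>\<^sup>+y. G (x(i\<^sub>0 := y)) \<partial>lborel \<partial>?M J)"
    by (rule lborel_prod.product_nn_integral_insert[OF J G])
  also have "\<dots> = (\<integral>\<^sup>+x. ennreal \<bar>1 / e i\<^sub>0\<bar> * (\<integral>\<^sup>+t. G (lift t x) \<partial>lborel) \<partial>?M J)"
  proof (rule nn_integral_cong)
    fix x assume "x \<in> space (?M J)"
    then have [measurable]: "(\<lambda>y. x(i\<^sub>0 := y)) \<in> lborel \<rightarrow>\<^sub>M ?M (insert i\<^sub>0 J)"
      by (intro measurable_fun_upd[where J=J]) auto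
    show "(\<integral>\<^sup>+y. G (x(i\<^sub>0 := y)) \<partial>lborel) = ennreal \<bar>1 / e i\<^sub>0\<bar> * (\<integral>\<^sup>+t. G (lift t x) \<partial>lborel)"
      using e by (subst nn_integral_real_affine[where c="1 / e i\<^sub>0" and t="- (\<Sum>i\<in>J. e i * x i) / e i\<^sub>0"])
        (auto simp: lift_def diff_divide_distrib)
  qed
  also have "\<dots> = ennreal \<bar>1 / e i\<^sub>0\<bar> * (\<integral>\<^sup>+x. \<integral>\<^sup>+t. G (lift t x) \<partial>lborel \<partial>?M J)"
    by (rule nn_integral_cmult) measurable
  also have "(\<integral>\<^sup>+x. \<integral>\<^sup>+t. G (lift t x) \<partial>lborel \<partial>?M J) = (\<integral>\<^sup>+t. \<integral>\<^sup>+x. G (lift t x) \<partial>?M J \<partial>lborel)"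
    by (rule MJ.Fubini'[symmetric]) measurable
  finally show ?thesis unfolding lift_def .
qed

text \<open>Replacing the coordinate \<open>i\<^sub>0\<close> by \<open>t = (\<Sum>i\<in>I. e i * x i)\<close> turns the shear, for each fixed \<open>t\<close>, into a
  translation of the remaining coordinates.\<close>

lemma nn_integral_PiM_lborel_shear:
  fixes F :: "('i \<Rightarrow> real) \<Rightarrow> ennreal"
  assumes I: "finite I" "i\<^sub>0 \<in> I" "e i\<^sub>0 \<noteq> 0"
    and w [measurable]: "\<And>i. (\<lambda>t. w t i) \<in> borel_measurable borel"
    and orth: "\<And>t. (\<Sum>i\<in>I. e i * w t i) = 0"
    and F [measurable]: "F \<in> borel_measurable (\<Pi>\<^sub>M i\<in>I. lborel)"
  shows "(\<integral>\<^sup>+x. F (\<lambda>i\<in>I. x i + w (\<Sum>i\<in>I. e i * x i) i) \<partial>(\<Pi>\<^sub>M i\<in>I. lborel)) = (\<integral>\<^sup>+x. F x \<partial>(\<Pi>\<^sub>M i\<in>I. lborel))"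
proof -
  obtain J where J: "finite J" "i\<^sub>0 \<notin> J" "I = insert i\<^sub>0 J"
    using I by (metis finite_insert mk_disjoint_insert)
  let ?M = "\<lambda>I. \<Pi>\<^sub>M i\<in>I. lborel :: real measure"
  define lift where "lift t x = x(i\<^sub>0 := (t - (\<Sum>i\<in>J. e i * x i)) / e i\<^sub>0)" for t and x :: "'i \<Rightarrow> real"
  have [measurable]: "(\<lambda>x. lift t x) \<in> ?M J \<rightarrow>\<^sub>M ?M I" for t
    unfolding lift_def J(3) by (intro measurable_fun_upd[where J=J]) auto
  have lift: "(\<integral>\<^sup>+x. G x \<partial>?M I) = ennreal \<bar>1 / e i\<^sub>0\<bar> * (\<integral>\<^sup>+t. \<integral>\<^sup>+x. G (lift t x) \<partial>?M J \<partial>lborel)"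
    if "G \<in> borel_measurable (?M I)" for G
    using that I(3) unfolding J(3) lift_def by (intro nn_integral_PiM_lborel_linear_form J)
  have shear_lift: "(\<lambda>i\<in>I. lift t x i + w (\<Sum>i\<in>I. e i * lift t x i) i) = lift t (\<lambda>i\<in>J. x i + w t i)" for t x
  proof -
    have "(\<Sum>i\<in>J. e i * lift t x i) = (\<Sum>i\<in>J. e i * x i)"
      using J(2) by (intro sum.cong) (auto simp: lift_def)
    then have t: "(\<Sum>i\<in>I. e i * lift t x i) = t"
      using J I(3) by (simp add: lift_def)
    have "e i\<^sub>0 * w t i\<^sub>0 = - (\<Sum>i\<in>J. e i * w t i)"
      using orth[of t] J by simp
    then have "lift t x i\<^sub>0 + w t i\<^sub>0 = lift t (\<lambda>i\<in>J. x i + w t i) i\<^sub>0"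
      using I(3) by (simp add: lift_def field_simps sum.distrib)
    then show ?thesis
      unfolding t using J by (auto simp: fun_eq_iff lift_def)
  qed
  have "(\<integral>\<^sup>+x. F (\<lambda>i\<in>I. x i + w (\<Sum>i\<in>I. e i * x i) i) \<partial>?M I)
      = ennreal \<bar>1 / e i\<^sub>0\<bar> * (\<integral>\<^sup>+t. \<integral>\<^sup>+x. F (lift t (\<lambda>i\<in>J. x i + w t i)) \<partial>?M J \<partial>lborel)"
    by (subst lift) (simp_all only: shear_lift, measurable)
  also have "\<dots> = ennreal \<bar>1 / e i\<^sub>0\<bar> * (\<integral>\<^sup>+t. \<integral>\<^sup>+x. F (lift t x) \<partial>?M J \<partial>lborel)"
    by (intro arg_cong2[where f="(*)"] refl nn_integral_cong nn_integral_PiM_lborel_translate J(1)) measurable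
  also have "\<dots> = (\<integral>\<^sup>+x. F x \<partial>?M I)"
    by (rule lift[symmetric]) measurable
  finally show ?thesis .
qed

text \<open>The Cameron--Martin formula for a shift that may depend on \<open>\<Sum>i. e i * x i\<close>, which the shift preserves.\<close>

lemma nn_integral_std_normal_tilt:
  fixes F :: "('i \<Rightarrow> real) \<Rightarrow> ennreal"
  assumes I: "finite I" "i\<^sub>0 \<in> I" "e i\<^sub>0 \<noteq> 0"
    and w [measurable]: "\<And>i. (\<lambda>t. w t i) \<in> borel_measurable borel"
    and orth: "\<And>t. (\<Sum>i\<in>I. e i * w t i) = 0"
    and F [measurable]: "F \<in> borel_measurable (\<Pi>\<^sub>M i\<in>I. borel)"
  shows "(\<integral>\<^sup>+x. ennreal (exp (\<Sum>i\<in>I. w (\<Sum>i\<in>I. e i * x i) i * x i - (w (\<Sum>i\<in>I. e i * x i) i)\<^sup>2 / 2)) * F x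
      \<partial>std_normal_prod I) = (\<integral>\<^sup>+x. F (\<lambda>i\<in>I. x i + w (\<Sum>i\<in>I. e i * x i) i) \<partial>std_normal_prod I)"
proof -
  let ?L = "\<Pi>\<^sub>M i\<in>I. lborel :: real measure"
  define form where "form x = (\<Sum>i\<in>I. e i * x i)" for x
  define shear where "shear x = (\<lambda>i\<in>I. x i + w (form x) i)" for x
  define dens where "dens x = (\<Prod>i\<in>I. normal_density 0 1 (x i))" for x :: "'i \<Rightarrow> real"
  define tilt where "tilt x = exp (\<Sum>i\<in>I. w (form x) i * x i - (w (form x) i)\<^sup>2 / 2)" for x
  have [measurable]: "F \<in> borel_measurable ?L"
    using F by (simp cong: measurable_cong_sets sets_PiM_cong)
  have [measurable]: "(\<lambda>x. shear x) \<in> (\<Pi>\<^sub>M i\<in>I. borel) \<rightarrow>\<^sub>M (\<Pi>\<^sub>M i\<in>I. borel)"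
    unfolding shear_def form_def by measurable
  have "form (shear x) = form x" for x
    using orth by (simp add: form_def shear_def distrib_left sum.distrib)
  then have "dens (shear x) * tilt (shear x) = dens x" for x
    using I(1) by (simp add: dens_def tilt_def exp_sum flip: prod.distrib)
      (simp add: shear_def normal_density_def power2_eq_square field_simps flip: exp_add)
  then have tilt_shear: "ennreal (dens (shear x)) * (ennreal (tilt (shear x)) * F (shear x))
      = ennreal (dens x) * F (shear x)" for x
    by (simp add: dens_def tilt_def prod_nonneg flip: mult.assoc ennreal_mult)
  have "(\<integral>\<^sup>+x. ennreal (tilt x) * F x \<partial>std_normal_prod I)
      = (\<integral>\<^sup>+x. ennreal (dens x) * (ennreal (tilt x) * F x) \<partial>?L)"
    unfolding dens_def tilt_def form_def by (rule nn_integral_std_normal_prod[OF I(1)]) measurable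
  also have "\<dots> = (\<integral>\<^sup>+x. ennreal (dens (shear x)) * (ennreal (tilt (shear x)) * F (shear x)) \<partial>?L)"
    unfolding shear_def form_def using I orth
    by (intro nn_integral_PiM_lborel_shear[symmetric]) (auto simp: dens_def tilt_def form_def)
  also have "\<dots> = (\<integral>\<^sup>+x. F (shear x) \<partial>std_normal_prod I)"
    unfolding tilt_shear unfolding dens_def by (rule nn_integral_std_normal_prod[OF I(1), symmetric]) measurable
  finally show ?thesis unfolding tilt_def shear_def form_def .
qed

lemma nn_integral_std_normal_tilt_mult:
  fixes a b e :: "'i \<Rightarrow> real" and g h :: "real \<Rightarrow> real"
  assumes I: "finite I" "i\<^sub>0 \<in> I" "e i\<^sub>0 \<noteq> 0"
    and [measurable]: "g \<in> borel_measurable borel" "h \<in> borel_measurable borel"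
    and orth: "(\<Sum>i\<in>I. e i * a i) = 0" "(\<Sum>i\<in>I. e i * b i) = 0"
  defines "t \<equiv> \<lambda>x. \<Sum>i\<in>I. e i * x i"
  shows "(\<integral>\<^sup>+x. ennreal (exp (g (t x) * (\<Sum>i\<in>I. a i * x i) - (\<Sum>i\<in>I. (a i)\<^sup>2) * (g (t x))\<^sup>2 / 2))
        * ennreal (exp (h (t x) * (\<Sum>i\<in>I. b i * x i) - (\<Sum>i\<in>I. (b i)\<^sup>2) * (h (t x))\<^sup>2 / 2)) \<partial>std_normal_prod I)
    = (\<integral>\<^sup>+x. ennreal (exp ((\<Sum>i\<in>I. a i * b i) * (g (t x) * h (t x)))) \<partial>std_normal_prod I)"
proof -
  have form: "(\<Sum>i\<in>I. e i * x i) = t x" for x by (simp add: t_def)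
  define w where "w t i = g t * a i + h t * b i" for t i
  have orth_w: "(\<Sum>i\<in>I. e i * w t i) = 0" for t
  proof -
    have "(\<Sum>i\<in>I. e i * w t i) = g t * (\<Sum>i\<in>I. e i * a i) + h t * (\<Sum>i\<in>I. e i * b i)"
      by (simp add: w_def algebra_simps sum.distrib sum_distrib_left)
    then show ?thesis using orth by simp
  qed
  have w_linear: "(\<Sum>i\<in>I. w t i * x i) = g t * (\<Sum>i\<in>I. a i * x i) + h t * (\<Sum>i\<in>I. b i * x i)" for t x
    by (simp add: w_def distrib_right sum.distrib sum_distrib_left mult.assoc)
  have w_square: "(\<Sum>i\<in>I. (w t i)\<^sup>2)
      = (\<Sum>i\<in>I. (a i)\<^sup>2) * (g t)\<^sup>2 + (\<Sum>i\<in>I. (b i)\<^sup>2) * (h t)\<^sup>2 + 2 * (\<Sum>i\<in>I. a i * b i) * (g t * h t)" for t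
    by (simp add: w_def power2_sum power_mult_distrib sum.distrib sum_distrib_left sum_distrib_right mult_ac)
  have expand: "(g t * (\<Sum>i\<in>I. a i * x i) - (\<Sum>i\<in>I. (a i)\<^sup>2) * (g t)\<^sup>2 / 2)
        + (h t * (\<Sum>i\<in>I. b i * x i) - (\<Sum>i\<in>I. (b i)\<^sup>2) * (h t)\<^sup>2 / 2)
      = (\<Sum>i\<in>I. w t i * x i - (w t i)\<^sup>2 / 2) + (\<Sum>i\<in>I. a i * b i) * (g t * h t)" for t x
    unfolding sum_subtractf sum_divide_distrib[symmetric] w_linear w_square by (simp add: add_divide_distrib)
  have "t (\<lambda>i\<in>I. x i + w (t x) i) = t x" for x
    using orth_w by (simp add: t_def distrib_left sum.distrib)
  moreover have "(\<lambda>t. w t i) \<in> borel_measurable borel" for i unfolding w_def by measurable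
  moreover have "(\<lambda>x. ennreal (exp ((\<Sum>i\<in>I. a i * b i) * (g (t x) * h (t x))))) \<in> borel_measurable (\<Pi>\<^sub>M i\<in>I. borel)"
    unfolding t_def by measurable
  ultimately show ?thesis
    using I nn_integral_std_normal_tilt[of I i\<^sub>0 e w "\<lambda>x. ennreal (exp ((\<Sum>i\<in>I. a i * b i) * (g (t x) * h (t x))))"] orth_w
    by (simp add: form expand flip: ennreal_mult exp_add)
qed

section \<open>Likelihood ratio of a random shift\<close>

text \<open>The likelihood ratio of a normally distributed shift \<open>a - z\<close>, where \<open>z\<close> has variance \<open>v\<close>, in a
  direction of squared length \<open>l\<close>; \<open>y\<close> is the inner product of the sample with that direction.\<close>

definition random_shift_lr :: "real \<Rightarrow> real \<Rightarrow> real \<Rightarrow> real \<Rightarrow> real" where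
  "random_shift_lr l v a y = exp ((v * y\<^sup>2 + 2 * a * y - l * a\<^sup>2) / (2 * (1 + l * v))) / sqrt (1 + l * v)"

lemma random_shift_lr_nonneg: "0 \<le> 1 + l * v \<Longrightarrow> 0 \<le> random_shift_lr l v a y"
  by (simp add: random_shift_lr_def)

lemma measurable_random_shift_lr [measurable (raw)]:
  assumes [measurable]: "f \<in> borel_measurable M" "g \<in> borel_measurable M"
  shows "(\<lambda>x. random_shift_lr l v (f x) (g x)) \<in> borel_measurable M"
  unfolding random_shift_lr_def by measurable

lemma nn_integral_random_shift:
  assumes v: "v > 0" and lv: "1 + l * v > 0"
  shows "(\<integral>\<^sup>+z. ennreal (exp ((a - z) * y - l * (a - z)\<^sup>2 / 2)) \<partial>normal_measure 0 v)
      = ennreal (random_shift_lr l v a y)"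
proof -
  have "(a - z) * y - l * (a - z)\<^sup>2 / 2 = (a * y - l * a\<^sup>2 / 2) + (- l * z\<^sup>2 / 2 + (l * a - y) * z)" for z
    by (simp add: power2_eq_square field_simps)
  then have "(\<integral>\<^sup>+z. ennreal (exp ((a - z) * y - l * (a - z)\<^sup>2 / 2)) \<partial>normal_measure 0 v)
      = ennreal (exp (a * y - l * a\<^sup>2 / 2)) * (\<integral>\<^sup>+z. ennreal (exp (- l * z\<^sup>2 / 2 + (l * a - y) * z)) \<partial>normal_measure 0 v)"
    by (simp add: exp_add ennreal_mult nn_integral_cmult)
  also have "\<dots> = ennreal (exp (a * y - l * a\<^sup>2 / 2)) * ennreal (exp (v * (l * a - y)\<^sup>2 / (2 * (1 + l * v))) / sqrt (1 + l * v))"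
    using v lv by (subst nn_integral_normal_exp_quadratic) (simp_all add: mult.commute)
  also have "\<dots> = ennreal (random_shift_lr l v a y)"
  proof -
    have "a * y - l * a\<^sup>2 / 2 + v * (l * a - y)\<^sup>2 / (2 * (1 + l * v))
        = (v * y\<^sup>2 + 2 * a * y - l * a\<^sup>2) / (2 * (1 + l * v))"
      using lv by (simp add: field_simps power2_eq_square)
    then show ?thesis
      using lv by (simp add: random_shift_lr_def flip: ennreal_mult exp_add)
  qed
  finally show ?thesis .
qed

definition variance_matched :: "real \<Rightarrow> real \<Rightarrow> real \<Rightarrow> real \<Rightarrow> bool" where
  "variance_matched k m \<tau> \<beta> \<longleftrightarrow> \<beta>\<^sup>2 * k * m + m * \<tau> = 2 * \<beta> * k"

lemma variance_matched_shift_variance: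
  assumes "variance_matched k m \<tau> \<beta>" "k > 0" "m > 0"
  shows "\<beta>\<^sup>2 * (k + m) + \<tau> * (k + m) / k = 2 * \<beta> * (k + m) / m"
proof -
  have "\<beta>\<^sup>2 * (k + m) + \<tau> * (k + m) / k = (\<beta>\<^sup>2 * k * m + m * \<tau>) * (k + m) / (k * m)"
    using assms(2,3) by (simp add: field_simps)
  also have "\<dots> = 2 * \<beta> * (k + m) / m"
    using assms by (simp add: variance_matched_def)
  finally show ?thesis .
qed

text \<open>Under variance matching, shifting the \<open>m\<close> remaining coordinates by a multiple of the planted sum \<open>r\<close>
  has the same effect as shifting along the centered indicator of the planted set, whose squared length
  is \<open>p * m\<close>, by a multiple of the total sum \<open>r + q\<close>.\<close>

lemma random_shift_lr_recenter:
  assumes match: "variance_matched k m \<tau> \<beta>" and pos: "k > 0" "m > 0"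
  defines "p \<equiv> k / (k + m)"
  shows "random_shift_lr m \<tau> (- \<beta> * r) q = random_shift_lr (p * m) (\<tau> / p) (- \<beta> * (r + q)) (r - p * (r + q))"
proof -
  define v where "v = \<tau> / p"
  have p: "p > 0" "k * (1 - p) = m * p" using pos by (simp_all add: p_def field_simps)
  have \<tau>: "\<tau> = p * v" using p by (simp add: v_def)
  have "k * ((1 - p) * v) = m * \<tau>"
    using p(2) by (simp add: \<tau> mult.assoc[symmetric])
  also have "\<dots> = k * (2 * \<beta> - \<beta>\<^sup>2 * m)"
    using match by (simp add: variance_matched_def algebra_simps)
  finally have v: "(1 - p) * v = 2 * \<beta> - \<beta>\<^sup>2 * m" using pos by simp
  have "v * (r - p * (r + q))\<^sup>2 + 2 * (- \<beta> * (r + q)) * (r - p * (r + q)) - p * m * (- \<beta> * (r + q))\<^sup>2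
      - (\<tau> * q\<^sup>2 + 2 * (- \<beta> * r) * q - m * (- \<beta> * r)\<^sup>2)
    = ((1 - p) * v - (2 * \<beta> - \<beta>\<^sup>2 * m)) * (r\<^sup>2 - p * (r + q)\<^sup>2)"
    unfolding \<tau> by (simp add: power2_eq_square algebra_simps)
  then have "v * (r - p * (r + q))\<^sup>2 + 2 * (- \<beta> * (r + q)) * (r - p * (r + q)) - p * m * (- \<beta> * (r + q))\<^sup>2
      = \<tau> * q\<^sup>2 + 2 * (- \<beta> * r) * q - m * (- \<beta> * r)\<^sup>2"
    unfolding v by simp
  moreover have "p * m * v = m * \<tau>" by (simp add: \<tau>)
  ultimately show ?thesis unfolding random_shift_lr_def v_def by simp
qed

lemma nn_integral_exp_random_shift_product:
  assumes v: "v > 0" and sv: "\<bar>s * v\<bar> < 1"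
  shows "(\<integral>\<^sup>+z. \<integral>\<^sup>+z'. ennreal (exp (s * ((a - z) * (a - z')))) \<partial>normal_measure 0 v \<partial>normal_measure 0 v)
    = ennreal (1 / sqrt (1 - (s * v)\<^sup>2) * exp (s * a\<^sup>2 / (1 - s * v)))"
proof -
  have sq: "(s * v)\<^sup>2 < 1" using sv by (simp add: abs_square_less_1)
  have factor: "1 - (s * v)\<^sup>2 = (1 - s * v) * (1 + s * v)"
    by (simp add: power2_eq_square algebra_simps)
  have nz: "1 - s * v \<noteq> 0" "1 + s * v \<noteq> 0" using sv by auto
  have inner: "(\<integral>\<^sup>+z'. ennreal (exp (s * ((a - z) * (a - z')))) \<partial>normal_measure 0 v)
      = ennreal (exp ((a - z) * (s * a) - (- (v * s\<^sup>2)) * (a - z)\<^sup>2 / 2))" for z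
  proof -
    have "(v * (s * (a - z))\<^sup>2 + 2 * a * (s * (a - z))) / 2 = (a - z) * (s * a) - (- (v * s\<^sup>2)) * (a - z)\<^sup>2 / 2"
      by (simp add: power_mult_distrib add_divide_distrib mult_ac)
    then show ?thesis
      using nn_integral_random_shift[of v 0 a "s * (a - z)"] v by (simp add: random_shift_lr_def mult_ac)
  qed
  have "(\<integral>\<^sup>+z. \<integral>\<^sup>+z'. ennreal (exp (s * ((a - z) * (a - z')))) \<partial>normal_measure 0 v \<partial>normal_measure 0 v)
      = ennreal (random_shift_lr (- (v * s\<^sup>2)) v a (s * a))"
    unfolding inner using v sq by (intro nn_integral_random_shift) (simp_all add: power2_eq_square mult_ac)
  also have "random_shift_lr (- (v * s\<^sup>2)) v a (s * a)
      = 1 / sqrt (1 - (s * v)\<^sup>2) * exp (2 * s * a\<^sup>2 * (1 + s * v) / (2 * (1 - (s * v)\<^sup>2)))"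
    by (simp add: random_shift_lr_def power2_eq_square algebra_simps)
  also have "2 * s * a\<^sup>2 * (1 + s * v) / (2 * (1 - (s * v)\<^sup>2)) = s * a\<^sup>2 / (1 - s * v)"
    unfolding factor using nz by simp
  finally show ?thesis .
qed

lemma nn_integral_exp_correlated_shift_product:
  assumes pos: "u > 0" "v > 0" and sv: "\<bar>s * v\<bar> < 1" and su: "2 * s * \<beta>\<^sup>2 * u + s * v < 1"
  shows "(\<integral>\<^sup>+t. \<integral>\<^sup>+z. \<integral>\<^sup>+z'. ennreal (exp (s * ((\<beta> * t - z) * (\<beta> * t - z'))))
        \<partial>normal_measure 0 v \<partial>normal_measure 0 v \<partial>normal_measure 0 u)
    = ennreal (1 / sqrt ((1 - s * \<beta>\<^sup>2 * u)\<^sup>2 - (s * (\<beta>\<^sup>2 * u + v))\<^sup>2))"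
proof -
  from sv have pos': "1 - s * v > 0" by auto
  define C where "C = 2 * s * \<beta>\<^sup>2 / (1 - s * v)"
  have C: "1 - u * C = (1 - s * v - 2 * (s * (\<beta>\<^sup>2 * u))) / (1 - s * v)"
    using pos' by (simp add: C_def field_simps)
  have uC: "0 < 1 - u * C"
    unfolding C using pos' su by (intro divide_pos_pos) (simp_all add: mult.assoc)
  have "(\<integral>\<^sup>+t. \<integral>\<^sup>+z. \<integral>\<^sup>+z'. ennreal (exp (s * ((\<beta> * t - z) * (\<beta> * t - z'))))
        \<partial>normal_measure 0 v \<partial>normal_measure 0 v \<partial>normal_measure 0 u)
      = (\<integral>\<^sup>+t. ennreal (1 / sqrt (1 - (s * v)\<^sup>2)) * ennreal (exp (C * t\<^sup>2 / 2 + 0 * t)) \<partial>normal_measure 0 u)"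
  proof (rule nn_integral_cong)
    fix t
    have "s * (\<beta> * t)\<^sup>2 / (1 - s * v) = C * t\<^sup>2 / 2 + 0 * t"
      using pos' by (simp add: C_def power_mult_distrib field_simps)
    then show "(\<integral>\<^sup>+z. \<integral>\<^sup>+z'. ennreal (exp (s * ((\<beta> * t - z) * (\<beta> * t - z')))) \<partial>normal_measure 0 v \<partial>normal_measure 0 v)
        = ennreal (1 / sqrt (1 - (s * v)\<^sup>2)) * ennreal (exp (C * t\<^sup>2 / 2 + 0 * t))"
      using sv pos(2) by (simp only: nn_integral_exp_random_shift_product) (simp add: abs_square_le_1 flip: ennreal_mult)
  qed
  also have "\<dots> = ennreal (1 / sqrt (1 - (s * v)\<^sup>2)) * ennreal (1 / sqrt (1 - u * C))"
    using uC nn_integral_normal_exp_quadratic[OF pos(1), of C 0] by (subst nn_integral_cmult) simp_all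
  also have "\<dots> = ennreal (1 / sqrt ((1 - (s * v)\<^sup>2) * (1 - u * C)))"
    using sv uC by (simp add: real_sqrt_mult abs_square_le_1 flip: ennreal_mult)
  also have "(1 - (s * v)\<^sup>2) * (1 - u * C) = (1 - s * \<beta>\<^sup>2 * u)\<^sup>2 - (s * (\<beta>\<^sup>2 * u + v))\<^sup>2"
  proof -
    have "1 - (s * v)\<^sup>2 = (1 - s * v) * (1 + s * v)"
      by (simp add: power2_eq_square algebra_simps)
    then have "(1 - (s * v)\<^sup>2) * (1 - u * C) = (1 + s * v) * (1 - s * v - 2 * (s * (\<beta>\<^sup>2 * u)))"
      unfolding C using pos' by simp
    then show ?thesis by (simp add: power2_eq_square algebra_simps)
  qed
  finally show ?thesis .
qed

section \<open>Overlap of two planted sets in one coordinate\<close>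

definition centered_indicator :: "'i set \<Rightarrow> 'i set \<Rightarrow> 'i \<Rightarrow> real" where
  "centered_indicator S A i = indicator A i - real (card A) / real (card S)"

lemma sum_indicator_mult_subset:
  fixes f :: "'i \<Rightarrow> real"
  assumes "finite S" "A \<subseteq> S"
  shows "(\<Sum>i\<in>S. indicator A i * f i) = (\<Sum>i\<in>A. f i)"
  using assms by (simp add: indicator_def if_distrib sum.If_cases Int_absorb1 cong: if_cong)

lemma sum_centered_indicator_mult:
  assumes "finite S" "A \<subseteq> S"
  shows "(\<Sum>i\<in>S. centered_indicator S A i * f i) = (\<Sum>i\<in>A. f i) - real (card A) / real (card S) * (\<Sum>i\<in>S. f i)"
  using assms
  by (simp only: centered_indicator_def left_diff_distrib sum_subtractf sum_indicator_mult_subset sum_distrib_left mult.assoc)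

lemma sum_centered_indicator:
  assumes "finite S" "A \<subseteq> S"
  shows "(\<Sum>i\<in>S. centered_indicator S A i) = 0"
  using sum_centered_indicator_mult[OF assms, of "\<lambda>_. 1"] assms card_mono[OF assms] by (cases "card S = 0") auto

lemma inner_centered_indicator:
  assumes S: "finite S" and A: "A \<subseteq> S" "A' \<subseteq> S"
  shows "(\<Sum>i\<in>S. centered_indicator S A i * centered_indicator S A' i)
    = real (card (A \<inter> A')) - real (card A) * real (card A') / real (card S)"
proof -
  have "(\<Sum>i\<in>A. centered_indicator S A' i) = real (card (A \<inter> A')) - real (card A) * real (card A') / real (card S)"
    using finite_subset[OF A(1) S]
      by (simp add: centered_indicator_def sum_subtractf indicator_def sum.If_cases Int_def)
  then show ?thesis
    using assms by (simp add: sum_centered_indicator_mult sum_centered_indicator)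
qed

definition planted_coordinate_lr :: "'i set \<Rightarrow> real \<Rightarrow> real \<Rightarrow> 'i set \<Rightarrow> ('i \<Rightarrow> real) \<Rightarrow> real" where
  "planted_coordinate_lr S \<tau> \<beta> A x = random_shift_lr (real (card (S - A))) \<tau> (- \<beta> * (\<Sum>i\<in>A. x i)) (\<Sum>i\<in>S - A. x i)"

lemma planted_coordinate_lr_nonneg: "\<tau> \<ge> 0 \<Longrightarrow> 0 \<le> planted_coordinate_lr S \<tau> \<beta> A x"
  by (simp add: planted_coordinate_lr_def random_shift_lr_nonneg)

lemma planted_coordinate_lr_eq_mixture:
  fixes x :: "'i \<Rightarrow> real"
  assumes S: "finite S" "A \<subseteq> S" and k: "card A = k" "0 < k" "k < card S"
    and \<tau>: "\<tau> > 0" and match: "variance_matched (real k) (real (card S - k)) \<tau> \<beta>"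
  defines "l \<equiv> (\<Sum>i\<in>S. (centered_indicator S A i)\<^sup>2)" and "\<theta> \<equiv> \<lambda>z. - \<beta> * (\<Sum>i\<in>S. x i) - z"
  shows "ennreal (planted_coordinate_lr S \<tau> \<beta> A x)
    = (\<integral>\<^sup>+z. ennreal (exp (\<theta> z * (\<Sum>i\<in>S. centered_indicator S A i * x i) - l * (\<theta> z)\<^sup>2 / 2))
        \<partial>normal_measure 0 (\<tau> * real (card S) / real k))"
proof -
  have n: "real k + real (card S - k) = real (card S)" using k by simp
  have l: "l = real k / real (card S) * real (card S - k)"
    using inner_centered_indicator[OF S(1) S(2) S(2)] k by (simp add: l_def power2_eq_square field_simps of_nat_diff)
  have "(\<Sum>i\<in>S. x i) = (\<Sum>i\<in>A. x i) + (\<Sum>i\<in>S - A. x i)"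
    using sum.subset_diff[OF S(2,1), of x] by (simp add: add.commute)
  moreover have "card (S - A) = card S - k" using S k by (simp add: card_Diff_subset finite_subset)
  ultimately have "planted_coordinate_lr S \<tau> \<beta> A x
      = random_shift_lr l (\<tau> * real (card S) / real k) (- \<beta> * (\<Sum>i\<in>S. x i)) (\<Sum>i\<in>S. centered_indicator S A i * x i)"
    using random_shift_lr_recenter[OF match, of "\<Sum>i\<in>A. x i" "\<Sum>i\<in>S - A. x i"] k n S
    by (simp add: planted_coordinate_lr_def l sum_centered_indicator_mult)
  moreover have "1 + l * (\<tau> * real (card S) / real k) > 0"
    using \<tau> by (intro add_pos_nonneg) (simp_all add: l)
  ultimately show ?thesis
    unfolding \<theta>_def using \<tau> k by (subst nn_integral_random_shift) auto
qed

lemma nn_integral_centered_tilt_mult: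
  fixes g h :: "real \<Rightarrow> real"
  assumes S: "finite S" "S \<noteq> {}" and A: "A \<subseteq> S" "A' \<subseteq> S"
    and gh: "g \<in> borel_measurable borel" "h \<in> borel_measurable borel"
  defines "T \<equiv> \<lambda>x. \<Sum>i\<in>S. x i" and "c \<equiv> centered_indicator S"
  shows "(\<integral>\<^sup>+x. ennreal (exp (g (T x) * (\<Sum>i\<in>S. c A i * x i) - (\<Sum>i\<in>S. (c A i)\<^sup>2) * (g (T x))\<^sup>2 / 2))
        * ennreal (exp (h (T x) * (\<Sum>i\<in>S. c A' i * x i) - (\<Sum>i\<in>S. (c A' i)\<^sup>2) * (h (T x))\<^sup>2 / 2)) \<partial>std_normal_prod S)
    = (\<integral>\<^sup>+x. ennreal (exp ((real (card (A \<inter> A')) - real (card A) * real (card A') / real (card S)) * (g (T x) * h (T x))))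
        \<partial>std_normal_prod S)"
proof -
  obtain i where "i \<in> S" using S by auto
  then show ?thesis
    using nn_integral_std_normal_tilt_mult[OF S(1), of i "\<lambda>_. 1" g h "c A" "c A'"] S A gh
    by (simp add: T_def c_def sum_centered_indicator inner_centered_indicator)
qed

text \<open>Both likelihood ratios are mixtures of tilts along the centered indicators, which are orthogonal to the
  all-ones vector.\<close>

lemma nn_integral_planted_coordinate_lr_mult_eq_mixture:
  fixes A A' :: "'i set"
  assumes S: "finite S" and A: "A \<subseteq> S" "A' \<subseteq> S" and k: "card A = k" "card A' = k" "0 < k" "k < card S"
    and \<tau>: "\<tau> > 0" and match: "variance_matched (real k) (real (card S - k)) \<tau> \<beta>"
    and s: "s = real (card (A \<inter> A')) - (real k)\<^sup>2 / real (card S)"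
    and v: "v = \<tau> * real (card S) / real k"
  shows "(\<integral>\<^sup>+x. ennreal (planted_coordinate_lr S \<tau> \<beta> A x * planted_coordinate_lr S \<tau> \<beta> A' x) \<partial>std_normal_prod S)
    = (\<integral>\<^sup>+t. \<integral>\<^sup>+z. \<integral>\<^sup>+z'. ennreal (exp (s * ((- \<beta> * t - z) * (- \<beta> * t - z'))))
        \<partial>normal_measure 0 v \<partial>normal_measure 0 v \<partial>normal_measure 0 (real (card S)))"
proof -
  let ?N = "normal_measure 0 v" and ?P = "std_normal_prod S"
  define T where "T x = (\<Sum>i\<in>S. x i)" for x :: "'i \<Rightarrow> real"
  define tilt where "tilt A z x = ennreal (exp ((- \<beta> * T x - z) * (\<Sum>i\<in>S. centered_indicator S A i * x i)
      - (\<Sum>i\<in>S. (centered_indicator S A i)\<^sup>2) * (- \<beta> * T x - z)\<^sup>2 / 2))" for A z x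
  define h where "h t z z' = ennreal (exp (s * ((- \<beta> * t - z) * (- \<beta> * t - z'))))" for t z z'
  have n: "card S > 0" "S \<noteq> {}" using k by auto
  have N: "sigma_finite_measure ?N"
    using \<tau> k n by (intro prob_space_imp_sigma_finite prob_space_normal_measure) (simp add: v)
  have [measurable]: "(\<lambda>(x, z). tilt A z x) \<in> borel_measurable (?P \<Otimes>\<^sub>M ?N)" for A
    unfolding tilt_def T_def by measurable
  have lr: "ennreal (planted_coordinate_lr S \<tau> \<beta> A x) = (\<integral>\<^sup>+z. tilt A z x \<partial>?N)" if "A \<subseteq> S" "card A = k" for A x
    unfolding tilt_def T_def v using that S k \<tau> match by (intro planted_coordinate_lr_eq_mixture) auto
  have overlap: "(\<integral>\<^sup>+x. tilt A z x * tilt A' z' x \<partial>?P) = (\<integral>\<^sup>+x. h (T x) z z' \<partial>?P)" for z z'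
    using nn_integral_centered_tilt_mult[OF S n(2) A, of "\<lambda>t. - \<beta> * t - z" "\<lambda>t. - \<beta> * t - z'"] k
    by (simp add: tilt_def T_def h_def s power2_eq_square[of "real k"])
  have "(\<integral>\<^sup>+x. ennreal (planted_coordinate_lr S \<tau> \<beta> A x * planted_coordinate_lr S \<tau> \<beta> A' x) \<partial>?P)
      = (\<integral>\<^sup>+x. \<integral>\<^sup>+z. \<integral>\<^sup>+z'. tilt A z x * tilt A' z' x \<partial>?N \<partial>?N \<partial>?P)"
    using A k \<tau> by (intro nn_integral_cong)
      (simp add: ennreal_mult planted_coordinate_lr_nonneg lr nn_integral_cmult nn_integral_multc del: space_PiM)
  also have "\<dots> = (\<integral>\<^sup>+z. \<integral>\<^sup>+z'. \<integral>\<^sup>+x. h (T x) z z' \<partial>?P \<partial>?N \<partial>?N)"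
    unfolding overlap[symmetric]
    by (intro nn_integral_swap_triple N prob_space_imp_sigma_finite[OF prob_space_std_normal_prod]) measurable
  also have "\<dots> = (\<integral>\<^sup>+z. \<integral>\<^sup>+z'. \<integral>\<^sup>+t. h t z z' \<partial>normal_measure 0 (real (card S)) \<partial>?N \<partial>?N)"
    unfolding T_def by (intro nn_integral_cong nn_integral_sum_std_normal_prod S n) (simp add: h_def)
  also have "\<dots> = (\<integral>\<^sup>+t. \<integral>\<^sup>+z. \<integral>\<^sup>+z'. h t z z' \<partial>?N \<partial>?N \<partial>normal_measure 0 (real (card S)))"
    using n by (intro nn_integral_swap_triple[symmetric] N prob_space_imp_sigma_finite prob_space_normal_measure)
      (simp_all add: h_def)
  finally show ?thesis unfolding h_def .
qed

lemma nn_integral_planted_coordinate_lr_mult: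
  fixes S A A' :: "'i set" and k :: nat
  defines "n \<equiv> real (card S)" and "m \<equiv> real (card S - k)" and "s \<equiv> real (card (A \<inter> A')) - (real k)\<^sup>2 / real (card S)"
  assumes S: "finite S" and A: "A \<subseteq> S" "A' \<subseteq> S" and k: "card A = k" "card A' = k" "0 < k" "k < card S"
    and \<tau>: "\<tau> > 0" and match: "variance_matched (real k) m \<tau> \<beta>" and small: "2 * (\<bar>s\<bar> * (2 * \<beta> * n / m)) < 1"
  shows "(\<integral>\<^sup>+x. ennreal (planted_coordinate_lr S \<tau> \<beta> A x * planted_coordinate_lr S \<tau> \<beta> A' x) \<partial>std_normal_prod S)
    = ennreal (1 / sqrt ((1 - s * \<beta>\<^sup>2 * n)\<^sup>2 - (s * (2 * \<beta> * n / m))\<^sup>2))"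
proof -
  define v where "v = \<tau> * n / real k"
  have m: "m > 0" "n = real k + m" using k by (auto simp: m_def n_def)
  have n: "n > 0" using m by simp
  have v: "v > 0" using \<tau> k n by (simp add: v_def)
  have total: "\<beta>\<^sup>2 * n + v = 2 * \<beta> * n / m"
    using variance_matched_shift_variance[OF match] k m by (simp add: v_def)
  have "\<bar>s * v\<bar> \<le> \<bar>s\<bar> * (\<beta>\<^sup>2 * n + v)" "\<bar>s * (\<beta>\<^sup>2 * n)\<bar> \<le> \<bar>s\<bar> * (\<beta>\<^sup>2 * n + v)"
    "\<bar>s\<bar> * (\<beta>\<^sup>2 * n + v) = \<bar>s * (\<beta>\<^sup>2 * n)\<bar> + \<bar>s * v\<bar>"
    using v n by (simp_all add: abs_mult distrib_left)
  then have "\<bar>s * v\<bar> < 1" "2 * s * \<beta>\<^sup>2 * n + s * v < 1"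
    using small unfolding total[symmetric] by (auto simp: abs_le_iff mult.assoc)
  then show ?thesis
    unfolding total[symmetric]
    using nn_integral_planted_coordinate_lr_mult_eq_mixture[OF S A k \<tau>, of \<beta> s v] match m v
      nn_integral_exp_correlated_shift_product[of n v s "- \<beta>"]
    by (simp add: s_def v_def n_def m_def)
qed

section \<open>Intersection of a fixed set with a uniformly random one\<close>

abbreviation subsets_of_card :: "'i set \<Rightarrow> nat \<Rightarrow> 'i set set" where
  "subsets_of_card S k \<equiv> {B. B \<subseteq> S \<and> card B = k}"

lemma binomial_diff_mult_power_le:
  "j \<le> k \<Longrightarrow> k \<le> n \<Longrightarrow> ((n - j) choose (k - j)) * n ^ j \<le> k ^ j * (n choose k)"
proof (induction j)
  case (Suc j)
  let ?C = "\<lambda>j. (n - j) choose (k - j)"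
  have n: "n - j = Suc (n - Suc j)" and k: "k - j = Suc (k - Suc j)" using Suc.prems by auto
  have absorb: "?C (Suc j) * (n - j) = (k - j) * ?C j"
    unfolding n k by (simp only: Suc_times_binomial mult.commute)
  have "(?C (Suc j) * n ^ Suc j) * (n - j) = ((k - j) * n) * (?C j * n ^ j)"
    using absorb by (simp add: mult_ac)
  also have "\<dots> \<le> (k * (n - j)) * (k ^ j * (n choose k))"
  proof (rule mult_mono)
    have "j * k \<le> j * n" using Suc.prems by simp
    then show "(k - j) * n \<le> k * (n - j)"
      using diff_le_mono2[of "j * k" "j * n" "k * n"] by (simp add: diff_mult_distrib diff_mult_distrib2 mult.commute)
  qed (use Suc in auto)
  also have "\<dots> = (k ^ Suc j * (n choose k)) * (n - j)" by simp
  finally show ?case using Suc.prems by (simp only: mult_le_cancel2)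
qed simp

lemma card_subsets_of_card_containing:
  assumes S: "finite S" and T: "T \<subseteq> S" "card T \<le> k"
  shows "card {B \<in> subsets_of_card S k. T \<subseteq> B} = (card S - card T) choose (k - card T)"
proof -
  have finT: "finite T" using S T finite_subset by blast
  have "bij_betw (\<lambda>B. B \<union> T) (subsets_of_card (S - T) (k - card T)) {B \<in> subsets_of_card S k. T \<subseteq> B}"
  proof (rule bij_betwI[where g="\<lambda>B. B - T"])
    show "(\<lambda>B. B \<union> T) \<in> subsets_of_card (S - T) (k - card T) \<rightarrow> {B \<in> subsets_of_card S k. T \<subseteq> B}"
    proof (rule Pi_I)
      fix B assume "B \<in> subsets_of_card (S - T) (k - card T)"
      then have B: "B \<subseteq> S - T" "card B = k - card T" by auto
      then have "card (B \<union> T) = card B + card T"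
        using S finT by (intro card_Un_disjoint) (auto intro: finite_subset)
      then show "B \<union> T \<in> {B \<in> subsets_of_card S k. T \<subseteq> B}" using B T by auto
    qed
    show "(\<lambda>B. B - T) \<in> {B \<in> subsets_of_card S k. T \<subseteq> B} \<rightarrow> subsets_of_card (S - T) (k - card T)"
      using card_Diff_subset[OF finT] by fastforce
  qed blast+
  then have "card {B \<in> subsets_of_card S k. T \<subseteq> B} = card (subsets_of_card (S - T) (k - card T))"
    by (rule bij_betw_same_card[symmetric])
  also have "\<dots> = card (S - T) choose (k - card T)"
    using S by (intro n_subsets) auto
  finally show ?thesis using T by (simp add: card_Diff_subset[OF finT])
qed

lemma card_subsets_of_card_containing_le:
  assumes S: "finite S" "S \<noteq> {}" and T: "T \<subseteq> S" and k: "k \<le> card S"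
  shows "real (card {B \<in> subsets_of_card S k. T \<subseteq> B}) \<le> real (card S choose k) * (real k / real (card S)) ^ card T"
proof (cases "card T \<le> k")
  case True
  have "card S > 0" using S by (simp add: card_gt_0_iff)
  moreover have "real (((card S - card T) choose (k - card T)) * card S ^ card T)
      \<le> real (k ^ card T * (card S choose k))"
    using binomial_diff_mult_power_le[OF True k] by (rule of_nat_mono)
  ultimately show ?thesis
    unfolding card_subsets_of_card_containing[OF S(1) T True] by (simp add: field_simps power_divide)
next
  case False
  have "card T \<le> card B" if "B \<in> subsets_of_card S k" "T \<subseteq> B" for B
    using that finite_subset[OF _ S(1)] by (intro card_mono) auto
  with False have empty: "{B \<in> subsets_of_card S k. T \<subseteq> B} = {}" by force
  show ?thesis unfolding empty by simp
qed

lemma sum_Pow_power_card: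
  fixes x :: "'a :: comm_semiring_1"
  shows "finite F \<Longrightarrow> (\<Sum>T\<in>Pow F. x ^ card T) = (x + 1) ^ card F"
  using prod_add[of F "\<lambda>_. x" "\<lambda>_. 1"] by simp

lemma sum_power_card_Int_le_of_ge_1:
  fixes y :: real
  assumes S: "finite S" "S \<noteq> {}" and A: "A \<subseteq> S" and k: "k \<le> card S" and y: "y \<ge> 1"
  shows "(\<Sum>B\<in>subsets_of_card S k. y ^ card (A \<inter> B))
    \<le> real (card S choose k) * (1 + (y - 1) * (real k / real (card S))) ^ card A"
proof -
  let ?p = "real k / real (card S)"
  have finA: "finite A" using S A finite_subset by blast
  have "(\<Sum>B\<in>subsets_of_card S k. y ^ card (A \<inter> B)) = (\<Sum>B\<in>subsets_of_card S k. \<Sum>T\<in>Pow (A \<inter> B). (y - 1) ^ card T)"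
    using finA by (intro sum.cong refl) (subst sum_Pow_power_card; simp)
  also have "\<dots> = (\<Sum>B\<in>subsets_of_card S k. \<Sum>T | T \<in> Pow A \<and> T \<subseteq> B. (y - 1) ^ card T)"
    by (intro sum.cong) auto
  also have "\<dots> = (\<Sum>T\<in>Pow A. \<Sum>B | B \<in> subsets_of_card S k \<and> T \<subseteq> B. (y - 1) ^ card T)"
    using finA S by (intro sum.swap_restrict) auto
  also have "\<dots> = (\<Sum>T\<in>Pow A. (y - 1) ^ card T * real (card {B \<in> subsets_of_card S k. T \<subseteq> B}))"
    by (simp add: mult.commute)
  also have "\<dots> \<le> (\<Sum>T\<in>Pow A. (y - 1) ^ card T * (real (card S choose k) * ?p ^ card T))"
    using A y by (intro sum_mono mult_left_mono card_subsets_of_card_containing_le S k) auto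
  also have "\<dots> = real (card S choose k) * (\<Sum>T\<in>Pow A. ((y - 1) * ?p) ^ card T)"
    by (simp only: sum_distrib_left power_mult_distrib mult_ac)
  also have "\<dots> = real (card S choose k) * (1 + (y - 1) * ?p) ^ card A"
    by (simp add: sum_Pow_power_card[OF finA] add.commute)
  finally show ?thesis .
qed

text \<open>For \<open>y < 1\<close> one counts the points of \<open>A\<close> in the complement of the random set.\<close>

lemma sum_power_card_Int_le:
  fixes y :: real
  assumes S: "finite S" "S \<noteq> {}" and A: "A \<subseteq> S" and k: "k \<le> card S" and y: "y > 0"
  shows "(\<Sum>B\<in>subsets_of_card S k. y ^ card (A \<inter> B))
    \<le> real (card S choose k) * (1 + (y - 1) * (real k / real (card S))) ^ card A"
proof (cases "y \<ge> 1")
  case True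
  then show ?thesis using assms by (intro sum_power_card_Int_le_of_ge_1)
next
  case False
  define n where "n = card S"
  have n: "n > 0" "k \<le> n" using S k by (auto simp: n_def card_gt_0_iff)
  have finA: "finite A" using S A finite_subset by blast
  have power: "y ^ card (A \<inter> B) = y ^ card A * (1 / y) ^ card (A \<inter> (S - B))" if "B \<in> subsets_of_card S k" for B
  proof -
    have "card A = card (A \<inter> B) + card (A \<inter> (S - B))"
      using finA A by (subst card_Un_disjoint[symmetric]) (auto intro: arg_cong[where f=card])
    then show ?thesis using y by (simp add: power_add power_divide)
  qed
  have bij: "bij_betw (\<lambda>B. S - B) (subsets_of_card S k) (subsets_of_card S (n - k))"
  proof -
    have "card (S - B) = n - card B" if "B \<subseteq> S" for B
      unfolding n_def using S that by (intro card_Diff_subset) (auto intro: finite_subset)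
    then show ?thesis
      using n by (intro bij_betwI[where g="\<lambda>B. S - B"]) (auto simp: double_diff)
  qed
  have "(\<Sum>B\<in>subsets_of_card S k. y ^ card (A \<inter> B))
      = y ^ card A * (\<Sum>B\<in>subsets_of_card S k. (1 / y) ^ card (A \<inter> (S - B)))"
    unfolding sum_distrib_left by (intro sum.cong refl power)
  also have "\<dots> = y ^ card A * (\<Sum>B\<in>subsets_of_card S (n - k). (1 / y) ^ card (A \<inter> B))"
    by (simp only: sum.reindex_bij_betw[OF bij, of "\<lambda>B. (1 / y) ^ card (A \<inter> B)"])
  also have "\<dots> \<le> y ^ card A * (real (n choose (n - k)) * (1 + (1 / y - 1) * (real (n - k) / real n)) ^ card A)"
    unfolding n_def using S A y False by (intro mult_left_mono sum_power_card_Int_le_of_ge_1) auto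
  also have "\<dots> = real (n choose k) * (y * (1 + (1 / y - 1) * (real (n - k) / real n))) ^ card A"
    using n by (simp add: binomial_symmetric[symmetric] power_mult_distrib)
  also have "y * (1 + (1 / y - 1) * (real (n - k) / real n)) = 1 + (y - 1) * (real k / real n)"
    using n y by (simp add: of_nat_diff field_simps)
  finally show ?thesis by (simp add: n_def)
qed

lemma exp_le_one_plus_square:
  fixes x :: real
  assumes "x \<le> 1"
  shows "exp x \<le> 1 + x + x\<^sup>2"
proof (cases "x \<ge> 0")
  case True
  then show ?thesis using exp_bound assms by blast
next
  case False
  then have "exp x \<le> 1 / (1 - x)"
    using exp_ge_add_one_self[of "- x"] by (simp add: exp_minus field_simps)
  also have "\<dots> \<le> 1 + x + x\<^sup>2"
  proof -
    have "(1 + x + x\<^sup>2) * (1 - x) = 1 - x ^ 3" by (simp add: power2_eq_square power3_eq_cube algebra_simps)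
    moreover have "x ^ 3 \<le> 0" using False by (simp add: power_le_zero_eq)
    ultimately show ?thesis using False by (simp add: divide_le_eq)
  qed
  finally show ?thesis .
qed

lemma sum_exp_centered_card_Int_le:
  fixes l :: real
  assumes S: "finite S" "S \<noteq> {}" and A: "A \<subseteq> S" and k: "k \<le> card S" and l: "l \<le> 1"
  defines "V \<equiv> real (card A) * real k / real (card S)"
  shows "(\<Sum>B\<in>subsets_of_card S k. exp (l * (real (card (A \<inter> B)) - V))) \<le> real (card S choose k) * exp (V * l\<^sup>2)"
proof -
  let ?p = "real k / real (card S)"
  have p: "0 \<le> ?p" "?p \<le> 1" using S k by (auto simp: divide_le_eq_1 card_gt_0_iff)
  have "exp l * ?p + (1 - ?p) \<ge> 0" using p by (intro add_nonneg_nonneg mult_nonneg_nonneg) auto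
  then have nonneg: "1 + (exp l - 1) * ?p \<ge> 0" by (simp add: left_diff_distrib diff_divide_distrib)
  have "(\<Sum>B\<in>subsets_of_card S k. exp (l * (real (card (A \<inter> B)) - V)))
      = exp (- l * V) * (\<Sum>B\<in>subsets_of_card S k. exp l ^ card (A \<inter> B))"
    by (simp add: sum_distrib_left right_diff_distrib exp_diff exp_minus field_simps flip: exp_of_nat_mult)
  also have "\<dots> \<le> exp (- l * V) * (real (card S choose k) * (1 + (exp l - 1) * ?p) ^ card A)"
    by (intro mult_left_mono sum_power_card_Int_le S A k) auto
  also have "\<dots> \<le> exp (- l * V) * (real (card S choose k) * exp ((exp l - 1) * ?p) ^ card A)"
    using nonneg by (intro mult_left_mono power_mono exp_ge_add_one_self) auto
  also have "\<dots> = real (card S choose k) * (exp (- l * V) * exp ((exp l - 1) * ?p) ^ card A)"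
    by (simp only: mult.left_commute)
  also have "exp (- l * V) * exp ((exp l - 1) * ?p) ^ card A = exp (V * (exp l - 1 - l))"
    by (simp add: V_def algebra_simps add_divide_distrib diff_divide_distrib flip: exp_of_nat_mult exp_add)
  also have "real (card S choose k) * exp (V * (exp l - 1 - l)) \<le> real (card S choose k) * exp (V * l\<^sup>2)"
    using exp_le_one_plus_square[OF l] by (intro mult_left_mono iffD2[OF exp_le_cancel_iff]) (auto simp: V_def)
  finally show ?thesis .
qed

lemma abs_card_Int_minus_mean_le:
  assumes S: "finite S" "card S > 0" and AB: "A \<subseteq> S" "card A = k"
  shows "\<bar>real (card (A \<inter> B)) - (real k)\<^sup>2 / real (card S)\<bar> \<le> real k"
proof -
  have "card (A \<inter> B) \<le> card A"
    using finite_subset[OF AB(1) S(1)] by (intro card_mono) auto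
  moreover have "(real k)\<^sup>2 / real (card S) \<le> real k"
    using card_mono[OF S(1) AB(1)] AB(2) S(2) by (simp add: field_simps power2_eq_square mult_left_mono)
  moreover have "(real k)\<^sup>2 / real (card S) \<ge> 0" by simp
  ultimately show ?thesis using AB(2) by linarith
qed

section \<open>Exponential moments of quadratic functions\<close>

lemma exp_square_le_sum_exp:
  fixes r s \<theta> \<eta> :: real
  assumes r: "r > 0" and \<theta>: "\<theta> \<ge> 0" "\<theta> * \<bar>s\<bar> \<le> \<eta>"
  shows "exp (\<theta> * s\<^sup>2) \<le> 1 + 2 * \<theta> / r\<^sup>2 * (\<Sum>l\<leftarrow>[r + \<eta>, r - \<eta>, - r + \<eta>, - r - \<eta>]. exp (l * s))"
proof -
  define E where "E = (\<Sum>l\<leftarrow>[r + \<eta>, r - \<eta>, - r + \<eta>, - r - \<eta>]. exp (l * s))"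
  have exp_abs: "exp \<bar>x\<bar> \<le> exp x + exp (- x)" for x :: real
    by (cases "x \<ge> 0") auto
  have nonneg: "r * \<bar>s\<bar> \<ge> 0" using r by simp
  have "(r * \<bar>s\<bar>)\<^sup>2 \<le> 2 * exp (r * \<bar>s\<bar>)"
    using exp_lower_Taylor_quadratic[OF nonneg] nonneg by linarith
  then have "s\<^sup>2 \<le> 2 * exp \<bar>r * s\<bar> / r\<^sup>2"
    using r by (simp add: abs_mult power_mult_distrib field_simps)
  also have "\<dots> \<le> 2 / r\<^sup>2 * (exp (r * s) + exp (- (r * s)))"
    using exp_abs[of "r * s"] by (simp add: divide_right_mono)
  finally have square: "s\<^sup>2 \<le> 2 / r\<^sup>2 * (exp (r * s) + exp (- (r * s)))" .
  have "\<theta> * s\<^sup>2 = (\<theta> * \<bar>s\<bar>) * \<bar>s\<bar>" by (simp add: power2_eq_square)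
  also have "\<dots> \<le> \<eta> * \<bar>s\<bar>" using \<theta> by (intro mult_right_mono) auto
  also have "\<dots> \<le> \<bar>\<eta> * s\<bar>" by (simp add: abs_mult mult_right_mono)
  finally have "exp (\<theta> * s\<^sup>2) \<le> exp (\<eta> * s) + exp (- (\<eta> * s))"
    using exp_abs[of "\<eta> * s"] by (meson exp_le_cancel_iff order_trans)
  then have "s\<^sup>2 * exp (\<theta> * s\<^sup>2)
      \<le> (2 / r\<^sup>2 * (exp (r * s) + exp (- (r * s)))) * (exp (\<eta> * s) + exp (- (\<eta> * s)))"
    using square by (intro mult_mono) (auto intro!: mult_nonneg_nonneg add_nonneg_nonneg)
  also have "\<dots> = 2 / r\<^sup>2 * E"
    by (simp add: E_def algebra_simps exp_add exp_diff exp_minus divide_inverse)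
  finally have "\<theta> * (s\<^sup>2 * exp (\<theta> * s\<^sup>2)) \<le> \<theta> * (2 / r\<^sup>2 * E)"
    using \<theta>(1) by (rule mult_left_mono)
  moreover have "exp (\<theta> * s\<^sup>2) \<le> 1 + (\<theta> * s\<^sup>2) * exp (\<theta> * s\<^sup>2)"
    using exp_ge_add_one_self[of "- (\<theta> * s\<^sup>2)"] by (simp add: exp_minus field_simps)
  ultimately have "exp (\<theta> * s\<^sup>2) \<le> 1 + 2 * \<theta> / r\<^sup>2 * E" by (simp add: mult_ac)
  then show ?thesis by (simp only: E_def)
qed

lemma exp_quadratic_le_sum_exp:
  fixes r s \<xi> \<theta> \<eta> :: real
  assumes "r > 0" "\<theta> \<ge> 0" "\<theta> * \<bar>s\<bar> \<le> \<eta>"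
  shows "exp (\<xi> * s + \<theta> * s\<^sup>2)
    \<le> exp (\<xi> * s) + 2 * \<theta> / r\<^sup>2 * (\<Sum>l\<leftarrow>[r + \<eta>, r - \<eta>, - r + \<eta>, - r - \<eta>]. exp ((\<xi> + l) * s))"
proof -
  have "exp (\<xi> * s + \<theta> * s\<^sup>2)
      \<le> exp (\<xi> * s) * (1 + 2 * \<theta> / r\<^sup>2 * (\<Sum>l\<leftarrow>[r + \<eta>, r - \<eta>, - r + \<eta>, - r - \<eta>]. exp (l * s)))"
    unfolding exp_add by (intro mult_left_mono exp_square_le_sum_exp assms) simp
  also have "\<dots> = exp (\<xi> * s) + 2 * \<theta> / r\<^sup>2 * (\<Sum>l\<leftarrow>[r + \<eta>, r - \<eta>, - r + \<eta>, - r - \<eta>]. exp ((\<xi> + l) * s))"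
    by (simp add: distrib_right[of \<xi>] exp_add distrib_left add_divide_distrib mult_ac)
  finally show ?thesis .
qed

lemma le_inverse_sqrt:
  fixes a V :: real
  assumes "V > 0" "V * a\<^sup>2 \<le> 1"
  shows "a \<le> 1 / sqrt V"
proof (rule power2_le_imp_le)
  show "a\<^sup>2 \<le> (1 / sqrt V)\<^sup>2" using assms by (simp add: power_divide field_simps)
qed (use assms in simp)

lemma sum_exp_quadratic_le:
  fixes s :: "'b \<Rightarrow> real" and \<xi> \<theta> N V b :: real
  assumes mgf: "\<And>l. \<bar>l\<bar> \<le> 1 \<Longrightarrow> (\<Sum>x\<in>K. exp (l * s x)) \<le> N * exp (V * l\<^sup>2)"
    and s: "\<And>x. x \<in> K \<Longrightarrow> \<bar>s x\<bar> \<le> b" and V: "V \<ge> 9" and N: "N \<ge> 0"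
    and \<xi>: "\<xi> \<ge> 0" "V * \<xi>\<^sup>2 \<le> 1" and \<theta>: "\<theta> \<ge> 0" "V * (\<theta> * b)\<^sup>2 \<le> 1"
  shows "(\<Sum>x\<in>K. exp (\<xi> * s x + \<theta> * (s x)\<^sup>2)) \<le> N * (exp (V * \<xi>\<^sup>2) + 8 * \<theta> * V * exp 9)"
proof -
  define r where "r = 1 / sqrt V"
  define \<eta> where "\<eta> = \<theta> * \<bar>b\<bar>"
  let ?L = "[r + \<eta>, r - \<eta>, - r + \<eta>, - r - \<eta>]"
  have r: "r > 0" "V * r\<^sup>2 = 1" "1 / r\<^sup>2 = V" using V by (auto simp: r_def power_divide)
  have "3 \<le> sqrt V" using V by (intro real_le_rsqrt) simp
  then have r3: "r \<le> 1 / 3" using V by (simp add: r_def field_simps)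
  have \<xi>r: "\<xi> \<le> r" unfolding r_def using V \<xi>(2) by (intro le_inverse_sqrt) auto
  have \<eta>: "0 \<le> \<eta>" "\<eta> \<le> r"
    using V \<theta> by (auto simp: \<eta>_def r_def power_mult_distrib intro!: le_inverse_sqrt)
  have mgf_shifted: "(\<Sum>x\<in>K. exp ((\<xi> + l) * s x)) \<le> N * exp 9" if "l \<in> set ?L" for l
  proof -
    have l: "\<bar>\<xi> + l\<bar> \<le> 3 * r" using that \<xi>(1) \<eta> \<xi>r by auto
    have "(\<xi> + l)\<^sup>2 \<le> (3 * r)\<^sup>2" using power_mono[OF l, of 2] by simp
    then have "V * (\<xi> + l)\<^sup>2 \<le> V * (3 * r)\<^sup>2" using V by simp
    also have "\<dots> = 9" using r(2) by (simp add: power_mult_distrib)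
    finally have "N * exp (V * (\<xi> + l)\<^sup>2) \<le> N * exp 9" using N by (simp add: mult_left_mono)
    then show ?thesis using mgf[of "\<xi> + l"] l r3 by linarith
  qed
  have "exp (\<xi> * s x + \<theta> * (s x)\<^sup>2) \<le> exp (\<xi> * s x) + 2 * \<theta> * V * (\<Sum>l\<leftarrow>?L. exp ((\<xi> + l) * s x))" if "x \<in> K" for x
  proof -
    have "\<theta> * \<bar>s x\<bar> \<le> \<eta>"
      unfolding \<eta>_def using s[OF that] \<theta>(1) by (intro mult_left_mono) auto
    from exp_quadratic_le_sum_exp[OF r(1) \<theta>(1) this] show ?thesis by (simp flip: r(3))
  qed
  then have "(\<Sum>x\<in>K. exp (\<xi> * s x + \<theta> * (s x)\<^sup>2)) \<le> (\<Sum>x\<in>K. exp (\<xi> * s x) + 2 * \<theta> * V * (\<Sum>l\<leftarrow>?L. exp ((\<xi> + l) * s x)))"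
    by (rule sum_mono)
  also have "\<dots> = (\<Sum>x\<in>K. exp (\<xi> * s x)) + 2 * \<theta> * V * (\<Sum>l\<leftarrow>?L. \<Sum>x\<in>K. exp ((\<xi> + l) * s x))"
    by (simp add: sum.distrib sum_distrib_left distrib_left)
  also have "\<dots> \<le> N * exp (V * \<xi>\<^sup>2) + 2 * \<theta> * V * (4 * (N * exp 9))"
  proof (intro add_mono mult_left_mono mgf)
    show "(\<Sum>l\<leftarrow>?L. \<Sum>x\<in>K. exp ((\<xi> + l) * s x)) \<le> 4 * (N * exp 9)"
      using mgf_shifted[of "r + \<eta>"] mgf_shifted[of "r - \<eta>"] mgf_shifted[of "- r + \<eta>"] mgf_shifted[of "- r - \<eta>"]
        by simp
  qed (use \<xi> \<theta> V \<xi>r r3 in auto)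
  finally show ?thesis by (simp add: algebra_simps)
qed

lemma sum_exp_quadratic_card_Int_le:
  fixes \<xi> \<theta> :: real
  assumes S: "finite S" "S \<noteq> {}" and A: "A \<subseteq> S" "card A = k"
  defines "V \<equiv> (real k)\<^sup>2 / real (card S)"
  assumes V: "V \<ge> 9" and \<xi>: "\<xi> \<ge> 0" "V * \<xi>\<^sup>2 \<le> 1" and \<theta>: "\<theta> \<ge> 0" "V * (\<theta> * real k)\<^sup>2 \<le> 1"
  shows "(\<Sum>B\<in>subsets_of_card S k. exp (\<xi> * (real (card (A \<inter> B)) - V) + \<theta> * (real (card (A \<inter> B)) - V)\<^sup>2))
    \<le> real (card S choose k) * (exp (V * \<xi>\<^sup>2) + 8 * \<theta> * V * exp 9)"
proof (rule sum_exp_quadratic_le[where b="real k"])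
  have k: "k \<le> card S" using card_mono[OF S(1) A(1)] A(2) by simp
  fix l :: real assume "\<bar>l\<bar> \<le> 1"
  then show "(\<Sum>B\<in>subsets_of_card S k. exp (l * (real (card (A \<inter> B)) - V))) \<le> real (card S choose k) * exp (V * l\<^sup>2)"
    using sum_exp_centered_card_Int_le[OF S A(1) k, of l] by (simp add: A(2) V_def power2_eq_square)
next
  have S0: "card S > 0" using S by (simp add: card_gt_0_iff)
  show "\<bar>real (card (A \<inter> B)) - V\<bar> \<le> real k" for B
    unfolding V_def by (rule abs_card_Int_minus_mean_le[OF S(1) S0 A])
qed (use V \<xi> \<theta> in auto)

lemma inverse_sqrt_power_le_exp:
  fixes x y u :: real
  assumes x: "\<bar>x\<bar> \<le> u / 4" and y: "\<bar>y\<bar> \<le> 4 * u" and u: "u \<le> 1 / 100"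
  shows "(1 - x)\<^sup>2 - y\<^sup>2 > 0" and "(1 / sqrt ((1 - x)\<^sup>2 - y\<^sup>2)) ^ d \<le> exp (real d * (x + 9 * u\<^sup>2))"
proof -
  define Z where "Z = 2 * x - x\<^sup>2 + y\<^sup>2"
  have u0: "0 \<le> u" using x by linarith
  have y2: "y\<^sup>2 \<le> 16 * u\<^sup>2" using power_mono[OF y, of 2] by (simp add: power_mult_distrib)
  have x2: "x\<^sup>2 \<le> u\<^sup>2" using x u0 by (intro abs_le_square_iff[THEN iffD1]) simp
  have u2: "u\<^sup>2 \<le> u / 100" using mult_right_mono[OF u u0] by (simp add: power2_eq_square)
  have Z: "\<bar>Z\<bar> \<le> u"
    using x y2 u2 x2 u0 zero_le_power2[of x] zero_le_power2[of y] unfolding Z_def by linarith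
  then have half: "\<bar>- Z\<bar> \<le> 1 / 2" using u by simp
  have Z2: "Z\<^sup>2 \<le> u\<^sup>2" using Z u0 by (intro abs_le_square_iff[THEN iffD1]) simp
  have eq: "(1 - x)\<^sup>2 - y\<^sup>2 = 1 - Z" by (simp add: Z_def power2_eq_square algebra_simps)
  have pos: "1 - Z > 0" using half by simp
  then show "(1 - x)\<^sup>2 - y\<^sup>2 > 0" by (simp add: eq)
  have "- Z - 2 * Z\<^sup>2 \<le> ln (1 - Z)"
    using abs_ln_one_plus_x_minus_x_bound[OF half] by (simp add: abs_le_iff)
  moreover have "Z + 2 * Z\<^sup>2 \<le> 2 * x + 18 * u\<^sup>2"
    using y2 Z2 zero_le_power2[of x] unfolding Z_def by linarith
  ultimately have "exp (- ln (1 - Z) / 2) ^ d \<le> exp (x + 9 * u\<^sup>2) ^ d" by (intro power_mono) auto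
  also have "exp (- ln (1 - Z) / 2) = 1 / sqrt (1 - Z)"
    using pos by (simp add: ln_sqrt[symmetric] exp_minus inverse_eq_divide)
  finally show "(1 / sqrt ((1 - x)\<^sup>2 - y\<^sup>2)) ^ d \<le> exp (real d * (x + 9 * u\<^sup>2))"
    by (simp add: eq flip: exp_of_nat_mult)
qed

section \<open>The planted distribution and its likelihood ratio\<close>

declare One_nat_def [simp del]

lemma gaussian_eq_PiM: "gaussian d m v = (\<Pi>\<^sub>M j\<in>{1..d}. normal_measure (m j) v)"
  by (simp add: gaussian_def normal_measure_def)

lemma prob_space_gaussian: "v > 0 \<Longrightarrow> prob_space (gaussian d m v)"
  unfolding gaussian_eq_PiM by (intro prob_space_PiM prob_space_normal_measure)

lemma null_dist_eq_PiM: "null_dist d n = (\<Pi>\<^sub>M i\<in>{1..n}. std_normal_prod {1..d})"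
  by (simp add: null_dist_def gaussian_eq_PiM)

lemma prob_space_null_dist: "prob_space (null_dist d n)"
  unfolding null_dist_eq_PiM by (intro prob_space_PiM std_normal.prob_space_axioms)

lemma sets_samples: "sets (samples d n) = sets (\<Pi>\<^sub>M i\<in>{1..n}. std_normal_prod {1..d})"
  by (intro sets_PiM_cong) auto

lemma gaussian_eq_density:
  "gaussian d \<mu> 1 = density (std_normal_prod {1..d}) (\<lambda>x. \<Prod>j\<in>{1..d}. ennreal (exp (\<mu> j * x j - (\<mu> j)\<^sup>2 / 2)))"
proof -
  have "gaussian d \<mu> 1 = (\<Pi>\<^sub>M j\<in>{1..d}. density (normal_measure 0 1) (\<lambda>x. ennreal (exp (\<mu> j * x - (\<mu> j)\<^sup>2 / 2))))"
    by (simp add: gaussian_eq_PiM density_std_normal_exp_shift)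
  also have "\<dots> = density (std_normal_prod {1..d}) (\<lambda>x. \<Prod>j\<in>{1..d}. ennreal (exp (\<mu> j * x j - (\<mu> j)\<^sup>2 / 2)))"
    by (rule PiM_density) (simp_all add: density_std_normal_exp_shift prob_space_imp_sigma_finite prob_space_normal_measure)
  finally show ?thesis .
qed

lemma PiM_gaussian_eq_density:
  assumes B: "finite B"
  shows "(\<Pi>\<^sub>M i\<in>B. gaussian d \<mu> 1) = density (\<Pi>\<^sub>M i\<in>B. std_normal_prod {1..d})
    (\<lambda>y. \<Prod>j\<in>{1..d}. ennreal (exp (\<mu> j * (\<Sum>i\<in>B. y i j) - real (card B) * (\<mu> j)\<^sup>2 / 2)))"
proof -
  have "(\<Pi>\<^sub>M i\<in>B. gaussian d \<mu> 1) = density (\<Pi>\<^sub>M i\<in>B. std_normal_prod {1..d})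
      (\<lambda>y. \<Prod>i\<in>B. \<Prod>j\<in>{1..d}. ennreal (exp (\<mu> j * y i j - (\<mu> j)\<^sup>2 / 2)))"
    unfolding gaussian_eq_density
    by (rule PiM_density[OF B])
      (simp_all add: prob_space_imp_sigma_finite prob_space_std_normal_prod prob_space_gaussian flip: gaussian_eq_density)
  moreover have "(\<Prod>i\<in>B. \<Prod>j\<in>{1..d}. ennreal (exp (\<mu> j * y i j - (\<mu> j)\<^sup>2 / 2)))
      = (\<Prod>j\<in>{1..d}. ennreal (exp (\<mu> j * (\<Sum>i\<in>B. y i j) - real (card B) * (\<mu> j)\<^sup>2 / 2)))" for y
    using B by (subst prod.swap) (simp add: prod_ennreal sum_subtractf sum_distrib_left flip: exp_sum)
  ultimately show ?thesis by simp
qed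

lemma nn_integral_gaussian_random_shift:
  assumes "\<tau> > 0" "l \<ge> 0"
  shows "(\<integral>\<^sup>+z. (\<Prod>j\<in>{1..d}. ennreal (exp ((a j - z j) * y j - l * (a j - z j)\<^sup>2 / 2))) \<partial>gaussian d (\<lambda>_. 0) \<tau>)
    = (\<Prod>j\<in>{1..d}. ennreal (random_shift_lr l \<tau> (a j) (y j)))"
proof -
  interpret N: product_prob_space "\<lambda>_::nat. normal_measure 0 \<tau>" UNIV
    using assms by (intro product_prob_spaceI prob_space_normal_measure)
  have "1 + l * \<tau> > 0" using assms by (intro add_pos_nonneg) auto
  then show ?thesis
    unfolding gaussian_eq_PiM using assms
    by (simp add: nn_integral_random_shift
        N.product_nn_integral_prod[of "{1..d}" "\<lambda>j z. ennreal (exp ((a j - z) * y j - l * (a j - z)\<^sup>2 / 2))"])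
qed

definition planted_dist ::
    "nat \<Rightarrow> nat \<Rightarrow> real \<Rightarrow> real \<Rightarrow> nat set \<Rightarrow> (nat \<Rightarrow> nat \<Rightarrow> real) measure" where
  "planted_dist d n \<tau> \<beta> A =
    do {
      X \<leftarrow> (\<Pi>\<^sub>M i\<in>A. gaussian d (\<lambda>_. 0) 1);
      z \<leftarrow> gaussian d (\<lambda>_. 0) \<tau>;
      Y \<leftarrow> (\<Pi>\<^sub>M i\<in>{1..n} - A. gaussian d (\<lambda>j. - \<beta> * (\<Sum>i\<in>A. X i j) - z j) 1);
      return (samples d n) (merge A ({1..n} - A) (X, Y))
    }"

definition planted_lr :: "nat \<Rightarrow> nat \<Rightarrow> real \<Rightarrow> real \<Rightarrow> nat set \<Rightarrow> (nat \<Rightarrow> nat \<Rightarrow> real) \<Rightarrow> real" where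
  "planted_lr d n \<tau> \<beta> A x = (\<Prod>j\<in>{1..d}. planted_coordinate_lr {1..n} \<tau> \<beta> A (\<lambda>i. x i j))"

lemma borel_measurable_std_normal_entry:
  assumes "i \<in> I" "j \<in> J"
  shows "(\<lambda>x. x i j) \<in> borel_measurable (\<Pi>\<^sub>M i\<in>I. std_normal_prod J)"
  using measurable_PiM_component2[OF assms, of "normal_measure 0 1"]
  by (simp only: measurable_cong_sets[OF refl sets_normal_measure])

lemma planted_lr_nonneg: "\<tau> \<ge> 0 \<Longrightarrow> 0 \<le> planted_lr d n \<tau> \<beta> A x"
  unfolding planted_lr_def by (intro prod_nonneg planted_coordinate_lr_nonneg ballI)

lemma measurable_planted_lr:
  assumes "A \<subseteq> {1..n}"
  shows "planted_lr d n \<tau> \<beta> A \<in> borel_measurable (\<Pi>\<^sub>M i\<in>{1..n}. std_normal_prod {1..d})"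
  unfolding planted_lr_def[abs_def] planted_coordinate_lr_def using assms
  by (intro borel_measurable_prod measurable_random_shift_lr borel_measurable_sum borel_measurable_times borel_measurable_const
      borel_measurable_std_normal_entry) auto

lemma bind_shifted_PiM_gaussian:
  fixes a :: "nat \<Rightarrow> real"
  assumes B: "finite B" and \<tau>: "\<tau> > 0"
  shows "gaussian d (\<lambda>_. 0) \<tau> \<bind> (\<lambda>z. \<Pi>\<^sub>M i\<in>B. gaussian d (\<lambda>j. a j - z j) 1)
      = density (\<Pi>\<^sub>M i\<in>B. std_normal_prod {1..d})
        (\<lambda>y. \<Prod>j\<in>{1..d}. ennreal (random_shift_lr (real (card B)) \<tau> (a j) (\<Sum>i\<in>B. y i j)))" (is ?bind)
    and "(\<lambda>z. \<Pi>\<^sub>M i\<in>B. gaussian d (\<lambda>j. a j - z j) 1)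
      \<in> gaussian d (\<lambda>_. 0) \<tau> \<rightarrow>\<^sub>M prob_algebra (\<Pi>\<^sub>M i\<in>B. std_normal_prod {1..d})" (is ?kernel)
proof -
  let ?N = "\<Pi>\<^sub>M i\<in>B. std_normal_prod {1..d}"
  define w where "w z y = (\<Prod>j\<in>{1..d}. ennreal (exp ((a j - z j) * (\<Sum>i\<in>B. y i j) - real (card B) * (a j - z j)\<^sup>2 / 2)))"
    for z y :: "_ \<Rightarrow> _"
  have density: "(\<Pi>\<^sub>M i\<in>B. gaussian d (\<lambda>j. a j - z j) 1) = density ?N (w z)" for z
    unfolding w_def by (rule PiM_gaussian_eq_density[OF B])
  have N: "sigma_finite_measure ?N"
    by (intro prob_space_imp_sigma_finite prob_space_PiM std_normal.prob_space_axioms)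
  have [measurable]: "(\<lambda>y. y i j) \<in> borel_measurable ?N" if "i \<in> B" "j \<in> {1..d}" for i j
    using that by (rule borel_measurable_std_normal_entry)
  have w: "(\<lambda>(z, y). w z y) \<in> borel_measurable (gaussian d (\<lambda>_. 0) \<tau> \<Otimes>\<^sub>M ?N)"
    unfolding w_def gaussian_eq_PiM by measurable
  have prob: "prob_space (density ?N (w z))" for z
    unfolding density[symmetric] by (intro prob_space_PiM prob_space_gaussian) simp
  show ?kernel
    unfolding density by (rule measurable_density_kernel[OF N w prob])
  show ?bind
    unfolding density bind_density[OF prob_space_gaussian[OF \<tau>] N w prob]
    unfolding w_def using \<tau> by (simp add: nn_integral_gaussian_random_shift)
qed

lemma bind_shifted_gaussian_eq_planted_lr:
  assumes A: "A \<subseteq> {1..n}" and \<tau>: "\<tau> > 0"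
  defines "B \<equiv> {1..n} - A"
  shows "gaussian d (\<lambda>_. 0) \<tau> \<bind> (\<lambda>z. \<Pi>\<^sub>M i\<in>B. gaussian d (\<lambda>j. - \<beta> * (\<Sum>i\<in>A. X i j) - z j) 1)
    = density (\<Pi>\<^sub>M i\<in>B. std_normal_prod {1..d}) (\<lambda>y. ennreal (planted_lr d n \<tau> \<beta> A (merge A B (X, y))))"
proof -
  have "(\<Sum>i\<in>A. merge A B (X, y) i j) = (\<Sum>i\<in>A. X i j)" "(\<Sum>i\<in>B. merge A B (X, y) i j) = (\<Sum>i\<in>B. y i j)" for y j
    by (auto intro!: sum.cong simp: merge_def B_def)
  moreover have "finite B" by (simp add: B_def)
  ultimately show ?thesis
    using \<tau> by (simp add: bind_shifted_PiM_gaussian(1) planted_lr_def planted_coordinate_lr_def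
        random_shift_lr_nonneg prod_ennreal flip: B_def)
qed

lemma planted_dist_eq_density:
  assumes A: "A \<subseteq> {1..n}" and \<tau>: "\<tau> > 0"
  shows "planted_dist d n \<tau> \<beta> A = density (null_dist d n) (\<lambda>x. ennreal (planted_lr d n \<tau> \<beta> A x))" (is ?density)
    and "prob_space (planted_dist d n \<tau> \<beta> A)" (is ?prob)
proof -
  let ?N = "std_normal_prod {1..d}" and ?S = "{1..n}" and ?Z = "gaussian d (\<lambda>_. 0) \<tau>"
  define B where "B = ?S - A"
  have AB: "A \<inter> B = {}" "A \<union> B = ?S" "finite A" "finite B"
    using A finite_subset[OF A] by (auto simp: B_def)
  define L where "L x = ennreal (planted_lr d n \<tau> \<beta> A x)" for x
  define Y where "Y X z = (\<Pi>\<^sub>M i\<in>B. gaussian d (\<lambda>j. - \<beta> * (\<Sum>i\<in>A. X i j) - z j) 1)" for X :: "nat \<Rightarrow> nat \<Rightarrow> real" and z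
  have L: "L \<in> borel_measurable (\<Pi>\<^sub>M i\<in>A \<union> B. ?N)"
    unfolding L_def AB(2) using measurable_planted_lr[OF A] by measurable
  have kernel: "Y X \<in> ?Z \<rightarrow>\<^sub>M prob_algebra (\<Pi>\<^sub>M i\<in>B. ?N)" for X
    unfolding Y_def by (rule bind_shifted_PiM_gaussian(2)[OF AB(4) \<tau>])
  have mixture: "?Z \<bind> Y X = density (\<Pi>\<^sub>M i\<in>B. ?N) (\<lambda>y. L (merge A B (X, y)))" for X
    unfolding Y_def L_def B_def by (rule bind_shifted_gaussian_eq_planted_lr[OF A \<tau>])
  have prob: "prob_space (density (\<Pi>\<^sub>M i\<in>B. ?N) (\<lambda>y. L (merge A B (X, y))))" for X
    unfolding mixture[symmetric] using prob_space_gaussian[OF \<tau>] kernel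
    by (intro prob_space_bind'[where M="?Z"]) (auto simp: space_prob_algebra)
  have "planted_dist d n \<tau> \<beta> A
      = (\<Pi>\<^sub>M i\<in>A. ?N) \<bind> (\<lambda>X. ?Z \<bind> (\<lambda>z. Y X z \<bind> (\<lambda>y. return (\<Pi>\<^sub>M i\<in>A \<union> B. ?N) (merge A B (X, y)))))"
    unfolding planted_dist_def Y_def B_def[symmetric] AB(2) return_sets_cong[OF sets_samples]
      by (simp add: gaussian_eq_PiM)
  also have "\<dots> = (\<Pi>\<^sub>M i\<in>A. ?N) \<bind> (\<lambda>X. (?Z \<bind> Y X) \<bind> (\<lambda>y. return (\<Pi>\<^sub>M i\<in>A \<union> B. ?N) (merge A B (X, y))))"
  proof (intro bind_cong refl bind_assoc[symmetric])
    fix X assume X: "X \<in> space (\<Pi>\<^sub>M i\<in>A. ?N)"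
    show "Y X \<in> ?Z \<rightarrow>\<^sub>M subprob_algebra (\<Pi>\<^sub>M i\<in>B. ?N)"
      by (rule measurable_prob_algebraD[OF kernel])
    show "(\<lambda>y. return (\<Pi>\<^sub>M i\<in>A \<union> B. ?N) (merge A B (X, y))) \<in> (\<Pi>\<^sub>M i\<in>B. ?N) \<rightarrow>\<^sub>M subprob_algebra (\<Pi>\<^sub>M i\<in>A \<union> B. ?N)"
      using measurable_compose[OF measurable_compose[OF measurable_Pair1'[OF X] measurable_merge] return_measurable] .
  qed
  also have "\<dots> = density (\<Pi>\<^sub>M i\<in>A \<union> B. ?N) L"
    unfolding mixture by (intro bind_density_return_merge prob_space_std_normal_prod AB L prob)
  finally show ?density
    unfolding L_def AB(2) null_dist_eq_PiM .
  moreover have "prob_space (density (\<Pi>\<^sub>M i\<in>A \<union> B. ?N) L)"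
    by (intro prob_space_density_PiM_Un prob_space_std_normal_prod AB L prob)
  ultimately show ?prob
    unfolding L_def AB(2) null_dist_eq_PiM by simp
qed

lemma measurable_planted_lr_pair:
  assumes "finite K" "\<And>A. A \<in> K \<Longrightarrow> A \<subseteq> {1..n}"
  shows "(\<lambda>(A, x). ennreal (planted_lr d n \<tau> \<beta> A x)) \<in> borel_measurable (uniform_count_measure K \<Otimes>\<^sub>M null_dist d n)"
proof -
  have "(\<lambda>(A, x). ennreal (planted_lr d n \<tau> \<beta> A x)) \<in> borel_measurable (count_space K \<Otimes>\<^sub>M null_dist d n)"
    using assms measurable_planted_lr
    by (intro measurable_pair_measure_countable1 countable_finite) (auto simp: null_dist_eq_PiM)
  then show ?thesis
    by (simp cong: measurable_cong_sets sets_pair_measure_cong add: sets_uniform_count_measure_count_space)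
qed

lemma alt_dist_eq_density:
  fixes d n :: nat and \<epsilon> \<alpha> \<beta> :: real
  defines "K \<equiv> subsets_of_card {1..n} (nat \<lfloor>\<epsilon> * real n\<rfloor>)"
  assumes K: "K \<noteq> {}" and \<tau>: "\<alpha>\<^sup>2 / real d > 0"
  shows "alt_dist d n \<epsilon> \<alpha> \<beta> = density (null_dist d n)
      (\<lambda>x. ennreal ((\<Sum>A\<in>K. planted_lr d n (\<alpha>\<^sup>2 / real d) \<beta> A x) / real (card K)))" (is ?density)
    and "prob_space (alt_dist d n \<epsilon> \<alpha> \<beta>)" (is ?prob)
proof -
  let ?\<tau> = "\<alpha>\<^sup>2 / real d" and ?U = "uniform_count_measure K" and ?N = "null_dist d n"
  let ?l = "\<lambda>A x. ennreal (planted_lr d n ?\<tau> \<beta> A x)"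
  have finK: "finite K" by (simp add: K_def)
  have K0: "real (card K) > 0" using finK K by (simp add: card_gt_0_iff)
  have planted: "planted_dist d n ?\<tau> \<beta> A = density ?N (?l A)" "prob_space (density ?N (?l A))" if "A \<in> K" for A
    using planted_dist_eq_density[of A n ?\<tau> d \<beta>] \<tau> that by (auto simp: K_def)
  have measurable_l: "(\<lambda>(A, x). ?l A x) \<in> borel_measurable (?U \<Otimes>\<^sub>M ?N)"
    using finK by (intro measurable_planted_lr_pair) (auto simp: K_def)
  have U: "prob_space ?U" using finK K by (rule prob_space_uniform_count_measure)
  have N: "sigma_finite_measure ?N"
    by (rule prob_space_imp_sigma_finite[OF prob_space_null_dist])
  have alt: "alt_dist d n \<epsilon> \<alpha> \<beta> = ?U \<bind> (\<lambda>A. density ?N (?l A))"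
  proof -
    have "alt_dist d n \<epsilon> \<alpha> \<beta> = ?U \<bind> planted_dist d n ?\<tau> \<beta>"
      unfolding alt_dist_def planted_dist_def K_def ..
    also have "\<dots> = ?U \<bind> (\<lambda>A. density ?N (?l A))"
      using planted(1) by (intro bind_cong refl) (simp add: space_uniform_count_measure)
    finally show ?thesis .
  qed
  have "(\<integral>\<^sup>+A. ?l A x \<partial>?U) = ennreal ((\<Sum>A\<in>K. planted_lr d n ?\<tau> \<beta> A x) / real (card K))" for x
    using finK K0 \<tau> planted_lr_nonneg[of ?\<tau> d n \<beta>]
    by (simp add: uniform_count_measure_def nn_integral_point_measure_finite sum_nonneg sum_divide_distrib
        flip: ennreal_mult sum_distrib_left)
  then show ?density
    unfolding alt using planted(2)
      by (subst bind_density[OF U N measurable_l]) (simp_all add: space_uniform_count_measure)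
  show ?prob
    unfolding alt using planted(2) U measurable_density_kernel[OF N measurable_l]
    by (intro prob_space_bind'[where M="?U"]) (auto simp: space_prob_algebra space_uniform_count_measure)
qed

lemma nn_integral_planted_lr_mult:
  assumes A: "A \<subseteq> {1..n}" "A' \<subseteq> {1..n}" and \<tau>: "\<tau> \<ge> 0"
  shows "(\<integral>\<^sup>+x. ennreal (planted_lr d n \<tau> \<beta> A x * planted_lr d n \<tau> \<beta> A' x) \<partial>null_dist d n)
    = (\<integral>\<^sup>+x. ennreal (planted_coordinate_lr {1..n} \<tau> \<beta> A x * planted_coordinate_lr {1..n} \<tau> \<beta> A' x) \<partial>std_normal_prod {1..n}) ^ d"
proof -
  let ?S = "{1..n}"
  define \<phi> where "\<phi> x = ennreal (planted_coordinate_lr ?S \<tau> \<beta> A x * planted_coordinate_lr ?S \<tau> \<beta> A' x)" for x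
  have \<phi>: "\<phi> \<in> borel_measurable (std_normal_prod ?S)"
    unfolding \<phi>_def planted_coordinate_lr_def using A
    by (intro measurable_compose[OF _ measurable_ennreal] borel_measurable_times measurable_random_shift_lr
        borel_measurable_sum borel_measurable_const) auto
  have "planted_coordinate_lr ?S \<tau> \<beta> C (restrict y ?S) = planted_coordinate_lr ?S \<tau> \<beta> C y" if "C \<subseteq> ?S" for C y
  proof -
    have "(\<Sum>i\<in>D. restrict y ?S i) = (\<Sum>i\<in>D. y i)" if "D \<subseteq> ?S" for D
      using that by (intro sum.cong) auto
    with that show ?thesis by (simp add: planted_coordinate_lr_def)
  qed
  then have "ennreal (planted_lr d n \<tau> \<beta> A x * planted_lr d n \<tau> \<beta> A' x) = (\<Prod>j\<in>{1..d}. \<phi> (\<lambda>i\<in>?S. x i j))" for x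
    using A \<tau> by (simp add: planted_lr_def \<phi>_def prod_ennreal planted_coordinate_lr_nonneg prod.distrib)
  then show ?thesis
    unfolding null_dist_eq_PiM using nn_integral_PiM_prod_columns[OF std_normal.prob_space_axioms, of ?S "{1..d}"
      "\<lambda>_. \<phi>"] \<phi>
    by (simp add: \<phi>_def[abs_def])
qed

lemma nn_integral_planted_lr_mult_le:
  assumes A: "A \<in> subsets_of_card {1..n} k" "A' \<in> subsets_of_card {1..n} k"
    and k: "0 < k" "2 * k \<le> n" and \<tau>: "\<tau> > 0"
    and \<beta>: "\<beta> \<ge> 0" "\<beta> * real n \<le> 1 / 100" and match: "variance_matched (real k) (real (n - k)) \<tau> \<beta>"
    and s: "s = real (card (A \<inter> A')) - (real k)\<^sup>2 / real n"
  shows "(\<integral>\<^sup>+x. ennreal (planted_lr d n \<tau> \<beta> A x * planted_lr d n \<tau> \<beta> A' x) \<partial>null_dist d n)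
    \<le> ennreal (exp (real d * \<beta>\<^sup>2 * real n * s + 9 * real d * \<beta>\<^sup>2 * s\<^sup>2))"
proof -
  define m where "m = real (n - k)"
  define u where "u = \<beta> * \<bar>s\<bar>"
  define x where "x = s * \<beta>\<^sup>2 * real n"
  define y where "y = s * (2 * \<beta> * real n / m)"
  have s_le: "\<bar>s\<bar> \<le> real k"
    unfolding s using abs_card_Int_minus_mean_le[of "{1..n}" A k A'] A k by auto
  have "u \<le> \<beta> * real n"
    unfolding u_def using \<beta>(1) s_le k by (intro mult_left_mono) auto
  then have u: "0 \<le> u" "u \<le> 1 / 100" using \<beta> by (auto simp: u_def)
  have "\<bar>x\<bar> = (\<beta> * real n) * u"
    using \<beta>(1) by (simp add: x_def u_def abs_mult power2_eq_square)
  also have "\<dots> \<le> 1 / 4 * u"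
    using u \<beta>(2) by (intro mult_right_mono) auto
  finally have x: "\<bar>x\<bar> \<le> u / 4" by simp
  have m: "real n \<le> 2 * m" "m > 0" using k by (auto simp: m_def)
  have "\<beta> * real n \<le> \<beta> * (2 * m)" using \<beta>(1) m by (intro mult_left_mono)
  then have "2 * \<beta> * real n / m \<le> 4 * \<beta>" using m by (simp add: field_simps)
  then have "\<bar>s\<bar> * (2 * \<beta> * real n / m) \<le> \<bar>s\<bar> * (4 * \<beta>)" by (intro mult_left_mono) auto
  then have y: "\<bar>s\<bar> * (2 * \<beta> * real n / m) \<le> 4 * u" "\<bar>y\<bar> \<le> 4 * u"
    using \<beta>(1) m by (simp_all add: u_def y_def abs_mult mult_ac)
  have small: "2 * (\<bar>s\<bar> * (2 * \<beta> * real n / m)) < 1" using y(1) u by linarith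
  have "(\<integral>\<^sup>+x. ennreal (planted_coordinate_lr {1..n} \<tau> \<beta> A x * planted_coordinate_lr {1..n} \<tau> \<beta> A' x) \<partial>std_normal_prod {1..n})
      = ennreal (1 / sqrt ((1 - x)\<^sup>2 - y\<^sup>2))"
    using nn_integral_planted_coordinate_lr_mult[of "{1..n}" A A' k \<tau> \<beta>] A k \<tau> match small
    by (simp add: s x_def y_def m_def)
  then have "(\<integral>\<^sup>+x. ennreal (planted_lr d n \<tau> \<beta> A x * planted_lr d n \<tau> \<beta> A' x) \<partial>null_dist d n)
      = ennreal ((1 / sqrt ((1 - x)\<^sup>2 - y\<^sup>2)) ^ d)"
    using A \<tau> inverse_sqrt_power_le_exp(1)[OF x y(2) u(2)] by (simp add: nn_integral_planted_lr_mult ennreal_power)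
  also have "\<dots> \<le> ennreal (exp (real d * (x + 9 * u\<^sup>2)))"
    by (intro ennreal_leI inverse_sqrt_power_le_exp x y u)
  also have "real d * (x + 9 * u\<^sup>2) = real d * \<beta>\<^sup>2 * real n * s + 9 * real d * \<beta>\<^sup>2 * s\<^sup>2"
    by (simp add: x_def u_def power_mult_distrib algebra_simps)
  finally show ?thesis .
qed

section \<open>The chi-square method\<close>

lemma tv_dist_density_le_L1:
  fixes f :: "'a \<Rightarrow> real"
  assumes M: "prob_space M" and f: "integrable M f" "\<And>x. f x \<ge> 0"
  shows "tv_dist M (density M (\<lambda>x. ennreal (f x))) \<le> (\<integral>x. \<bar>1 - f x\<bar> \<partial>M)"
  unfolding tv_dist_def
proof (rule cSUP_least)
  interpret prob_space M by fact
  fix E assume [measurable]: "E \<in> sets M"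
  have E: "integrable M (\<lambda>x. indicator E x :: real)"
    by (intro integrable_real_indicator) (auto simp: less_top[symmetric])
  have fE: "integrable M (\<lambda>x. f x * indicator E x)"
    using f(1) by (intro integrable_real_mult_indicator) simp_all
  have "emeasure (density M (\<lambda>x. ennreal (f x))) E = (\<integral>\<^sup>+x. ennreal (f x * indicator E x) \<partial>M)"
    using f(1) by (simp add: emeasure_density ennreal_mult'' ennreal_indicator f(2))
  also have "\<dots> = ennreal (\<integral>x. f x * indicator E x \<partial>M)"
    using fE f(2) by (intro nn_integral_eq_integral) auto
  finally have "measure (density M (\<lambda>x. ennreal (f x))) E = (\<integral>x. f x * indicator E x \<partial>M)"
    using f(2) by (simp add: measure_def)
  then have "measure M E - measure (density M (\<lambda>x. ennreal (f x))) E = (\<integral>x. indicator E x - f x * indicator E x \<partial>M)"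
    using E fE by (subst Bochner_Integration.integral_diff) simp_all
  also have "\<bar>\<dots>\<bar> \<le> (\<integral>x. \<bar>indicator E x - f x * indicator E x\<bar> \<partial>M)"
    by (rule integral_abs_bound)
  also have "\<dots> \<le> (\<integral>x. \<bar>1 - f x\<bar> \<partial>M)"
    using E fE f(1) by (intro integral_mono integrable_abs Bochner_Integration.integrable_diff)
      (simp_all add: indicator_def)
  finally show "\<bar>measure M E - measure (density M (\<lambda>x. ennreal (f x))) E\<bar> \<le> (\<integral>x. \<bar>1 - f x\<bar> \<partial>M)" .
qed auto

lemma tv_dist_density_le_second_moment:
  fixes f :: "'a \<Rightarrow> real"
  assumes M: "prob_space M" and f [measurable]: "f \<in> borel_measurable M" and f_nonneg: "\<And>x. f x \<ge> 0"
    and dens: "prob_space (density M (\<lambda>x. ennreal (f x)))"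
    and second_moment: "(\<integral>\<^sup>+x. ennreal ((f x)\<^sup>2) \<partial>M) \<le> ennreal (1 + \<delta>\<^sup>2)" and \<delta>: "\<delta> \<ge> 0"
  shows "tv_dist M (density M (\<lambda>x. ennreal (f x))) \<le> \<delta>"
proof -
  interpret prob_space M by fact
  have "(\<integral>\<^sup>+x. ennreal (f x) \<partial>M) = 1"
    using prob_space.emeasure_space_1[OF dens] by (simp add: emeasure_density cong: nn_integral_cong)
  then have f_int: "integrable M f" "expectation f = 1"
    using f_nonneg by (auto simp: integral_eq_nn_integral intro!: integrableI_nonneg)
  have f2_int: "integrable M (\<lambda>x. (f x)\<^sup>2)"
    using second_moment by (intro integrableI_nonneg) (auto simp: le_less_trans)
  have "ennreal (expectation (\<lambda>x. (f x)\<^sup>2)) \<le> ennreal (1 + \<delta>\<^sup>2)"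
    using second_moment f2_int by (simp add: nn_integral_eq_integral del: ennreal_plus)
  then have f2: "expectation (\<lambda>x. (f x)\<^sup>2) \<le> 1 + \<delta>\<^sup>2" by (subst (asm) ennreal_le_iff) auto
  have square: "\<bar>1 - f x\<bar>\<^sup>2 = 1 - 2 * f x + (f x)\<^sup>2" for x
    by (simp add: power2_eq_square algebra_simps)
  have "0 \<le> variance (\<lambda>x. \<bar>1 - f x\<bar>)" by (rule variance_positive)
  also have "\<dots> = expectation (\<lambda>x. \<bar>1 - f x\<bar>\<^sup>2) - (expectation (\<lambda>x. \<bar>1 - f x\<bar>))\<^sup>2"
    using f_int f2_int by (intro variance_eq) (auto simp: square simp del: power2_abs)
  also have "expectation (\<lambda>x. \<bar>1 - f x\<bar>\<^sup>2) \<le> \<delta>\<^sup>2"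
    unfolding square using f_int f2_int f2 by (simp add: prob_space)
  finally have "(expectation (\<lambda>x. \<bar>1 - f x\<bar>))\<^sup>2 \<le> \<delta>\<^sup>2" by simp
  then have "expectation (\<lambda>x. \<bar>1 - f x\<bar>) \<le> \<delta>" using \<delta> by (rule power2_le_imp_le)
  with tv_dist_density_le_L1[OF M f_int(1) f_nonneg] show ?thesis by (rule order_trans)
qed

lemma tv_dist_density_average_le:
  fixes f :: "'b \<Rightarrow> 'a \<Rightarrow> real"
  assumes M: "prob_space M" and K: "finite K" "K \<noteq> {}"
    and f: "\<And>a. a \<in> K \<Longrightarrow> f a \<in> borel_measurable M" "\<And>a x. a \<in> K \<Longrightarrow> f a x \<ge> 0"
    and dens: "prob_space (density M (\<lambda>x. ennreal ((\<Sum>a\<in>K. f a x) / real (card K))))"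
    and overlap: "\<And>a b. a \<in> K \<Longrightarrow> b \<in> K \<Longrightarrow> (\<integral>\<^sup>+x. ennreal (f a x * f b x) \<partial>M) \<le> ennreal (g a b)"
    and g: "\<And>a b. a \<in> K \<Longrightarrow> b \<in> K \<Longrightarrow> g a b \<ge> 0" "\<And>a. a \<in> K \<Longrightarrow> (\<Sum>b\<in>K. g a b) \<le> real (card K) * (1 + \<delta>\<^sup>2)"
    and \<delta>: "\<delta> \<ge> 0"
  shows "tv_dist M (density M (\<lambda>x. ennreal ((\<Sum>a\<in>K. f a x) / real (card K)))) \<le> \<delta>"
proof (rule tv_dist_density_le_second_moment[OF M _ _ dens _ \<delta>])
  note f(1)[measurable]
  have K0: "real (card K) > 0" using K by (simp add: card_gt_0_iff)
  show "(\<lambda>x. (\<Sum>a\<in>K. f a x) / real (card K)) \<in> borel_measurable M" by measurable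
  show "(\<Sum>a\<in>K. f a x) / real (card K) \<ge> 0" for x
    using f(2) by (intro divide_nonneg_nonneg sum_nonneg) auto
  have "(\<integral>\<^sup>+x. ennreal (((\<Sum>a\<in>K. f a x) / real (card K))\<^sup>2) \<partial>M)
      = (\<integral>\<^sup>+x. ennreal (1 / (real (card K))\<^sup>2) * (\<Sum>a\<in>K. \<Sum>b\<in>K. ennreal (f a x * f b x)) \<partial>M)"
  proof (rule nn_integral_cong)
    fix x
    have "((\<Sum>a\<in>K. f a x) / real (card K))\<^sup>2 = 1 / (real (card K))\<^sup>2 * (\<Sum>a\<in>K. \<Sum>b\<in>K. f a x * f b x)"
      by (simp add: power_divide sum_product[symmetric] power2_eq_square)
    then show "ennreal (((\<Sum>a\<in>K. f a x) / real (card K))\<^sup>2)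
        = ennreal (1 / (real (card K))\<^sup>2) * (\<Sum>a\<in>K. \<Sum>b\<in>K. ennreal (f a x * f b x))"
      using f(2) by (simp add: ennreal_mult[symmetric] sum_nonneg)
  qed
  also have "\<dots> = ennreal (1 / (real (card K))\<^sup>2) * (\<Sum>a\<in>K. \<Sum>b\<in>K. \<integral>\<^sup>+x. ennreal (f a x * f b x) \<partial>M)"
    by (subst nn_integral_cmult) (auto simp: nn_integral_sum)
  also have "\<dots> \<le> ennreal (1 / (real (card K))\<^sup>2) * (\<Sum>a\<in>K. \<Sum>b\<in>K. ennreal (g a b))"
    by (intro mult_left_mono sum_mono overlap) auto
  also have "\<dots> = ennreal (1 / (real (card K))\<^sup>2 * (\<Sum>a\<in>K. \<Sum>b\<in>K. g a b))"
    using g(1) by (simp add: ennreal_mult[symmetric] sum_nonneg)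
  also have "\<dots> \<le> ennreal (1 + \<delta>\<^sup>2)"
  proof (rule ennreal_leI)
    have "(\<Sum>a\<in>K. \<Sum>b\<in>K. g a b) \<le> (\<Sum>a\<in>K. real (card K) * (1 + \<delta>\<^sup>2))"
      by (intro sum_mono g(2))
    then show "1 / (real (card K))\<^sup>2 * (\<Sum>a\<in>K. \<Sum>b\<in>K. g a b) \<le> 1 + \<delta>\<^sup>2"
      using K0 by (simp add: field_simps power2_eq_square)
  qed
  finally show "(\<integral>\<^sup>+x. ennreal (((\<Sum>a\<in>K. f a x) / real (card K))\<^sup>2) \<partial>M) \<le> ennreal (1 + \<delta>\<^sup>2)" .
qed

lemma tv_dist_null_alt_le:
  fixes d n k :: nat and \<epsilon> \<alpha> \<beta> V :: real
  assumes d: "d \<ge> 1" and \<alpha>: "\<alpha> > 0" and k: "nat \<lfloor>\<epsilon> * real n\<rfloor> = k" "2 * k \<le> n"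
    and \<beta>: "\<beta> \<ge> 0" "\<beta> * real n \<le> 1 / 100" and match: "variance_matched (real k) (real (n - k)) (\<alpha>\<^sup>2 / real d) \<beta>"
    and V: "V = (real k)\<^sup>2 / real n" "V \<ge> 9"
    and small: "V * (real d * \<beta>\<^sup>2 * real n)\<^sup>2 \<le> 1" "V * (9 * real d * \<beta>\<^sup>2 * real k)\<^sup>2 \<le> 1"
    and chi: "exp (V * (real d * \<beta>\<^sup>2 * real n)\<^sup>2) + 8 * (9 * real d * \<beta>\<^sup>2) * V * exp 9 \<le> 1 + \<delta>\<^sup>2" "\<delta> \<ge> 0"
  shows "tv_dist (null_dist d n) (alt_dist d n \<epsilon> \<alpha> \<beta>) \<le> \<delta>"
proof -
  let ?K = "subsets_of_card {1..n} k" and ?l = "planted_lr d n (\<alpha>\<^sup>2 / real d) \<beta>"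
  let ?s = "\<lambda>A B. real (card (A \<inter> B)) - V"
  let ?g = "\<lambda>A B. exp (real d * \<beta>\<^sup>2 * real n * ?s A B + 9 * real d * \<beta>\<^sup>2 * (?s A B)\<^sup>2)"
  have k0: "0 < k" using V by (cases "k = 0") auto
  have \<tau>: "\<alpha>\<^sup>2 / real d > 0" using d \<alpha> by simp
  have card_K: "card ?K = n choose k" using n_subsets[of "{1..n}" k] by simp
  then have K: "?K \<noteq> {}" using k(2) card_gt_0_iff[of ?K] by simp
  have row: "(\<Sum>B\<in>?K. ?g A B) \<le> real (card ?K) * (1 + \<delta>\<^sup>2)" if A: "A \<in> ?K" for A
  proof -
    have "(\<Sum>B\<in>?K. ?g A B)
        \<le> real (n choose k) * (exp (V * (real d * \<beta>\<^sup>2 * real n)\<^sup>2) + 8 * (9 * real d * \<beta>\<^sup>2) * V * exp 9)"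
      using sum_exp_quadratic_card_Int_le[of "{1..n}" A k "real d * \<beta>\<^sup>2 * real n"
        "9 * real d * \<beta>\<^sup>2"] A V small k0 k(2)
      by simp
    also have "\<dots> \<le> real (card ?K) * (1 + \<delta>\<^sup>2)"
      unfolding card_K by (intro mult_left_mono chi) simp
    finally show ?thesis .
  qed
  have overlap: "(\<integral>\<^sup>+x. ennreal (?l A x * ?l B x) \<partial>null_dist d n) \<le> ennreal (?g A B)" if "A \<in> ?K" "B \<in> ?K" for A B
    using that k k0 \<tau> \<beta> match V(1) by (intro nn_integral_planted_lr_mult_le) auto
  note alt = alt_dist_eq_density[of n \<epsilon> \<alpha> d \<beta>, unfolded k(1), OF K \<tau>]
  show ?thesis
    unfolding alt(1)
  proof (rule tv_dist_density_average_le[where g="?g"])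
    show "prob_space (density (null_dist d n) (\<lambda>x. ennreal ((\<Sum>A\<in>?K. ?l A x) / real (card ?K))))"
      using alt by simp
    show "?l A \<in> borel_measurable (null_dist d n)" if "A \<in> ?K" for A
      unfolding null_dist_eq_PiM using that by (intro measurable_planted_lr) simp
    show "?l A x \<ge> 0" for A x
      using \<tau> by (intro planted_lr_nonneg) simp
  qed (use K chi(2) prob_space_null_dist overlap row in simp_all)
qed

section \<open>Choice of the parameters\<close>

lemma variance_matched_exists:
  fixes k m \<tau> :: real
  assumes k: "k > 0" and m: "m > 0" and \<tau>: "\<tau> \<ge> 0" and small: "m\<^sup>2 * \<tau> / k \<le> 1"
  obtains \<beta> where "\<beta> \<ge> 0" "variance_matched k m \<tau> \<beta>" "\<beta> * m \<le> m\<^sup>2 * \<tau> / k"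
proof -
  define \<omega> where "\<omega> = m\<^sup>2 * \<tau> / k"
  define q where "q = sqrt (1 - \<omega>)"
  define \<beta> where "\<beta> = (1 - q) / m"
  have \<omega>: "0 \<le> \<omega>" "\<omega> \<le> 1" using assms by (auto simp: \<omega>_def)
  then have q: "0 \<le> q" "q \<le> 1" "q\<^sup>2 = 1 - \<omega>" by (auto simp: q_def)
  have "q\<^sup>2 \<le> q" using mult_right_mono[OF q(2,1)] by (simp add: power2_eq_square)
  then have \<beta>m: "\<beta> * m = 1 - q" "1 - q \<le> \<omega>" using m q(3) by (simp_all add: \<beta>_def)
  have "(\<beta> * m)\<^sup>2 + \<omega> = 2 * (\<beta> * m)"
    unfolding \<beta>m using q(3) by (simp add: power2_eq_square algebra_simps)
  moreover have "k / m * ((\<beta> * m)\<^sup>2 + \<omega>) = \<beta>\<^sup>2 * k * m + m * \<tau>" "k / m * (2 * (\<beta> * m)) = 2 * \<beta> * k"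
    using k m by (simp_all add: \<omega>_def field_simps power2_eq_square)
  ultimately have "variance_matched k m \<tau> \<beta>"
    unfolding variance_matched_def by metis
  moreover have "\<beta> \<ge> 0" using q m by (simp add: \<beta>_def)
  ultimately show ?thesis using that \<beta>m by (simp add: \<omega>_def)
qed

locale sparse_regime =
  fixes d n k :: nat and \<epsilon> \<alpha> c :: real
  assumes d_pos: "d \<ge> 1" and \<epsilon>_pos: "0 < \<epsilon>" and \<alpha>: "0 < \<alpha>" "\<alpha> \<le> 1" and c: "0 < c" "c \<le> 1 / 10 ^ 9"
    and k_eq: "real k = \<epsilon> * real n"
    and n_cube_le: "real n ^ 3 * \<alpha> ^ 8 \<le> c ^ 3 * (real d)\<^sup>2 * \<epsilon>\<^sup>2"
    and n_le: "real n * \<alpha>\<^sup>2 \<le> c * real d * \<epsilon>"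
    and d_le: "real d \<le> (real n)\<^sup>2 * \<alpha> ^ 4"
    and d_\<epsilon>_cube_le: "real d * \<epsilon> ^ 3 \<le> real n * \<alpha> ^ 4"

lemma sparse_regimeI:
  fixes d n :: nat and \<epsilon> \<alpha> c :: real
  assumes d: "d \<ge> 1" and \<epsilon>: "0 \<le> \<epsilon>" and \<alpha>: "0 < \<alpha>" "\<alpha> \<le> 1" and int: "\<epsilon> * real n \<in> \<int>" and c: "0 < c" "c \<le> 1 / 10 ^ 9"
    and upper: "real n \<le> c * min (real d powr (2/3) * \<epsilon> powr (2/3) / \<alpha> powr (8/3)) (real d * \<epsilon> / \<alpha>\<^sup>2)"
    and lower: "real n \<ge> sqrt (real d) / \<alpha>\<^sup>2 + real d * \<epsilon> ^ 3 / \<alpha> ^ 4"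
  shows "sparse_regime d n (nat \<lfloor>\<epsilon> * real n\<rfloor>) \<epsilon> \<alpha> c"
proof
  let ?P = "real d powr (2/3) * \<epsilon> powr (2/3) / \<alpha> powr (8/3)"
  have d0: "real d > 0" using d by simp
  have "c * min ?P (real d * \<epsilon> / \<alpha>\<^sup>2) \<le> c * ?P" "c * min ?P (real d * \<epsilon> / \<alpha>\<^sup>2) \<le> c * (real d * \<epsilon> / \<alpha>\<^sup>2)"
    by (intro mult_left_mono; use c in simp)+
  with upper have upper1: "real n \<le> c * ?P" and upper2: "real n \<le> c * (real d * \<epsilon> / \<alpha>\<^sup>2)" by linarith+
  have "sqrt (real d) / \<alpha>\<^sup>2 > 0" "real d * \<epsilon> ^ 3 / \<alpha> ^ 4 \<ge> 0" using d0 \<alpha> \<epsilon> by auto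
  with lower have lower1: "sqrt (real d) / \<alpha>\<^sup>2 \<le> real n" and lower2: "real d * \<epsilon> ^ 3 / \<alpha> ^ 4 \<le> real n"
      and n0: "real n > 0"
    by linarith+
  show n_le: "real n * \<alpha>\<^sup>2 \<le> c * real d * \<epsilon>" using upper2 \<alpha> by (simp add: field_simps)
  have "real n * \<alpha>\<^sup>2 > 0" using n0 \<alpha> by simp
  with n_le \<epsilon> show \<epsilon>0: "0 < \<epsilon>" by (cases "\<epsilon> = 0") auto
  have cube: "(x powr (a / 3)) ^ 3 = x powr a" if "x > 0" for x a :: real
    using that by (simp add: powr_power)
  have "real n ^ 3 \<le> (c * ?P) ^ 3" using upper1 by (intro power_mono) auto
  also have "\<dots> = c ^ 3 * ((real d powr (2/3)) ^ 3 * (\<epsilon> powr (2/3)) ^ 3 / (\<alpha> powr (8/3)) ^ 3)"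
    by (simp add: power_mult_distrib power_divide)
  also have "\<dots> = c ^ 3 * ((real d)\<^sup>2 * \<epsilon>\<^sup>2 / \<alpha> ^ 8)"
    unfolding cube[OF d0] cube[OF \<epsilon>0] cube[OF \<alpha>(1)] using d0 \<epsilon>0 \<alpha> by (simp add: powr_numeral)
  finally show "real n ^ 3 * \<alpha> ^ 8 \<le> c ^ 3 * (real d)\<^sup>2 * \<epsilon>\<^sup>2" using \<alpha> by (simp add: field_simps)
  have "sqrt (real d) \<le> real n * \<alpha>\<^sup>2" using lower1 \<alpha> by (simp add: field_simps)
  then have "(sqrt (real d))\<^sup>2 \<le> (real n * \<alpha>\<^sup>2)\<^sup>2" by (intro power_mono) auto
  then show "real d \<le> (real n)\<^sup>2 * \<alpha> ^ 4" by (simp add: power_mult_distrib)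
  show "real d * \<epsilon> ^ 3 \<le> real n * \<alpha> ^ 4" using lower2 \<alpha> by (simp add: field_simps)
  show "real (nat \<lfloor>\<epsilon> * real n\<rfloor>) = \<epsilon> * real n" using int \<epsilon>0 by (auto elim!: Ints_cases)
qed (use d \<alpha> c in auto)

context sparse_regime
begin

definition mean_overlap :: real where
  "mean_overlap = (real k)\<^sup>2 / real n"

lemma d_real_pos: "real d > 0"
  using d_pos by simp

lemma n_pos: "real n > 0"
  using d_le d_pos by (cases "n = 0") auto

lemma mean_overlap_eq: "mean_overlap = \<epsilon>\<^sup>2 * real n"
  using n_pos by (simp add: mean_overlap_def k_eq power2_eq_square)

lemma mean_overlap_nonneg: "mean_overlap \<ge> 0"
  by (simp add: mean_overlap_def)

lemma signal_le: "real n * \<alpha>\<^sup>2 / (real d * \<epsilon>) \<le> c"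
  using n_le d_real_pos \<epsilon>_pos by (simp add: field_simps)

lemma \<alpha>_square_le: "\<alpha>\<^sup>2 \<le> 1"
  using \<alpha> by (simp add: power_le_one)

lemma \<epsilon>_square_le: "\<epsilon>\<^sup>2 \<le> c"
proof -
  have "(real d * \<epsilon>) * \<epsilon>\<^sup>2 = real d * \<epsilon> ^ 3" by (simp add: power2_eq_square power3_eq_cube)
  also have "\<dots> \<le> (real n * \<alpha>\<^sup>2) * \<alpha>\<^sup>2" using d_\<epsilon>_cube_le by (simp add: power2_eq_square power4_eq_xxxx mult_ac)
  also have "\<dots> \<le> (c * real d * \<epsilon>) * 1" by (rule mult_mono[OF n_le \<alpha>_square_le]) (use c \<epsilon>_pos in auto)
  also have "\<dots> = (real d * \<epsilon>) * c" by simp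
  finally show ?thesis using d_real_pos \<epsilon>_pos by (simp add: mult_le_cancel_left_pos)
qed

lemma \<epsilon>_le_half: "\<epsilon> \<le> 1 / 2"
proof (rule power2_le_imp_le)
  show "\<epsilon>\<^sup>2 \<le> (1 / 2)\<^sup>2" using \<epsilon>_square_le c by (simp add: power2_eq_square)
qed simp

lemma two_k_le: "2 * k \<le> n"
  using mult_right_mono[OF \<epsilon>_le_half, of "real n"] by (simp add: k_eq flip: of_nat_le_iff[where ?'a=real])

lemma c_le_thousandth: "c \<le> 1 / 1000"
  using c by simp

lemma c_cube_le: "c ^ 3 \<le> 1 / 10 ^ 27"
  using power_mono[OF c(2), of 3] c(1) by (simp add: power_divide)

lemma mean_overlap_ge_9: "9 \<le> mean_overlap"
proof -
  have "real n ^ 3 * \<alpha> ^ 8 \<le> c ^ 3 * (real d)\<^sup>2 * \<epsilon>\<^sup>2" by (rule n_cube_le)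
  also have "\<dots> \<le> c ^ 3 * ((real n)\<^sup>2 * \<alpha> ^ 4)\<^sup>2 * \<epsilon>\<^sup>2"
    using d_le c by (intro mult_right_mono mult_left_mono power_mono) auto
  also have "\<dots> = (real n ^ 3 * \<alpha> ^ 8) * (c ^ 3 * mean_overlap)"
    unfolding mean_overlap_eq by (simp add: power2_eq_square power3_eq_cube mult_ac flip: power_add)
  finally have "1 \<le> c ^ 3 * mean_overlap" using n_pos \<alpha> by (simp add: mult_le_cancel_left1)
  also have "\<dots> \<le> 1 / 10 ^ 27 * mean_overlap" by (intro mult_right_mono c_cube_le mean_overlap_nonneg)
  finally show ?thesis by simp
qed

lemma ex_variance_matched_shift:
  "\<exists>\<beta>\<ge>0. variance_matched (real k) (real (n - k)) (\<alpha>\<^sup>2 / real d) \<beta> \<and> \<beta> \<le> 2 * \<alpha>\<^sup>2 / (real d * \<epsilon>)"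
proof -
  define m where "m = real (n - k)"
  have m: "m > 0" "m \<le> real n" "real n \<le> 2 * m" using two_k_le n_pos by (auto simp: m_def)
  have k0: "real k > 0" using k_eq \<epsilon>_pos n_pos by simp
  have "m\<^sup>2 * (\<alpha>\<^sup>2 / real d) / real k \<le> (real n)\<^sup>2 * (\<alpha>\<^sup>2 / real d) / real k"
    using m by (intro divide_right_mono mult_right_mono power_mono) auto
  also have "\<dots> = real n * \<alpha>\<^sup>2 / (real d * \<epsilon>)"
    using n_pos \<epsilon>_pos d_real_pos by (simp add: k_eq power2_eq_square)
  finally have signal: "m\<^sup>2 * (\<alpha>\<^sup>2 / real d) / real k \<le> real n * \<alpha>\<^sup>2 / (real d * \<epsilon>)" .
  then have "m\<^sup>2 * (\<alpha>\<^sup>2 / real d) / real k \<le> 1" using signal_le c_le_thousandth by linarith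
  then obtain \<beta> where \<beta>: "\<beta> \<ge> 0" "variance_matched (real k) m (\<alpha>\<^sup>2 / real d) \<beta>"
    "\<beta> * m \<le> m\<^sup>2 * (\<alpha>\<^sup>2 / real d) / real k"
    using variance_matched_exists[OF k0 m(1)] by (metis divide_nonneg_nonneg of_nat_0_le_iff zero_le_power2)
  have "\<beta> * real n \<le> \<beta> * (2 * m)" using \<beta>(1) m by (intro mult_left_mono) auto
  also have "\<dots> \<le> 2 * (real n * \<alpha>\<^sup>2 / (real d * \<epsilon>))" using \<beta>(3) signal by simp
  finally have "real n * \<beta> \<le> real n * (2 * \<alpha>\<^sup>2 / (real d * \<epsilon>))" by (simp add: mult_ac)
  then have "\<beta> \<le> 2 * \<alpha>\<^sup>2 / (real d * \<epsilon>)" using n_pos by (simp only: mult_le_cancel_left_pos)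
  with \<beta> show ?thesis unfolding m_def by blast
qed

context
  fixes \<beta> :: real
  assumes \<beta>: "\<beta> \<ge> 0" "\<beta> \<le> 2 * \<alpha>\<^sup>2 / (real d * \<epsilon>)"
begin

lemma shift_times_n_le: "\<beta> * real n \<le> 1 / 100"
proof -
  have "\<beta> * real n \<le> 2 * \<alpha>\<^sup>2 / (real d * \<epsilon>) * real n" by (intro mult_right_mono \<beta>) simp
  also have "\<dots> = 2 * (real n * \<alpha>\<^sup>2 / (real d * \<epsilon>))" by simp
  finally show ?thesis using signal_le c_le_thousandth by linarith
qed

lemma d_shift_square_le: "real d * \<beta>\<^sup>2 \<le> 4 * \<alpha> ^ 4 / (real d * \<epsilon>\<^sup>2)"
proof -
  have "real d * \<beta>\<^sup>2 \<le> real d * (2 * \<alpha>\<^sup>2 / (real d * \<epsilon>))\<^sup>2"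
    using \<beta> by (intro mult_left_mono power_mono) auto
  then show ?thesis using d_real_pos by (simp add: power2_eq_square power4_eq_xxxx mult_ac)
qed

lemma linear_coefficient_le: "mean_overlap * (real d * \<beta>\<^sup>2 * real n)\<^sup>2 \<le> 16 * c ^ 3"
proof -
  have "mean_overlap * (real d * \<beta>\<^sup>2 * real n)\<^sup>2 \<le> mean_overlap * (4 * \<alpha> ^ 4 / (real d * \<epsilon>\<^sup>2) * real n)\<^sup>2"
    by (intro mult_left_mono power_mono mult_right_mono d_shift_square_le mean_overlap_nonneg) auto
  also have "\<dots> = 16 * (real n ^ 3 * \<alpha> ^ 8 / ((real d)\<^sup>2 * \<epsilon>\<^sup>2))"
  proof -
    have "\<alpha> ^ 8 = (\<alpha> ^ 4)\<^sup>2" by simp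
    then show ?thesis
      unfolding mean_overlap_eq using d_real_pos \<epsilon>_pos
        by (simp only:) (simp add: field_simps power2_eq_square power3_eq_cube)
  qed
  also have "\<dots> \<le> 16 * c ^ 3"
    using n_cube_le d_real_pos \<epsilon>_pos by (simp add: field_simps)
  finally show ?thesis .
qed

lemma quadratic_range_le: "mean_overlap * (9 * real d * \<beta>\<^sup>2 * real k)\<^sup>2 \<le> 1"
proof -
  have "mean_overlap * (9 * real d * \<beta>\<^sup>2 * real k)\<^sup>2 = 81 * \<epsilon>\<^sup>2 * (mean_overlap * (real d * \<beta>\<^sup>2 * real n)\<^sup>2)"
    by (simp add: k_eq power_mult_distrib)
  also have "\<dots> \<le> 81 * c * (16 * c ^ 3)"
    using \<epsilon>_square_le c mean_overlap_nonneg by (intro mult_mono linear_coefficient_le) auto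
  also have "\<dots> \<le> 81 * 1 * (16 * (1 / 10 ^ 27))"
    using c c_cube_le by (intro mult_mono) auto
  also have "\<dots> \<le> 1" by simp
  finally show ?thesis .
qed

lemma quadratic_coefficient_le: "real d * \<beta>\<^sup>2 * mean_overlap \<le> 4 * c"
proof -
  have "real d * \<beta>\<^sup>2 * mean_overlap \<le> 4 * \<alpha> ^ 4 / (real d * \<epsilon>\<^sup>2) * mean_overlap"
    by (intro mult_right_mono d_shift_square_le mean_overlap_nonneg)
  also have "\<dots> = 4 * (real n * \<alpha>\<^sup>2 / (real d * \<epsilon>)) * (\<epsilon> * \<alpha>\<^sup>2)"
    unfolding mean_overlap_eq using d_real_pos \<epsilon>_pos by (simp add: field_simps power2_eq_square power4_eq_xxxx)
  also have "\<dots> \<le> 4 * c * (1 * 1)"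
  proof (rule mult_mono)
    show "\<epsilon> * \<alpha>\<^sup>2 \<le> 1 * 1" by (rule mult_mono[OF _ \<alpha>_square_le]) (use \<epsilon>_le_half in auto)
  qed (use signal_le c \<epsilon>_pos in auto)
  finally show ?thesis by simp
qed

lemma chi_square_le:
  "exp (mean_overlap * (real d * \<beta>\<^sup>2 * real n)\<^sup>2) + 8 * (9 * real d * \<beta>\<^sup>2) * mean_overlap * exp 9 \<le> 1 + 0.1\<^sup>2"
proof -
  have "mean_overlap * (real d * \<beta>\<^sup>2 * real n)\<^sup>2 \<le> 1 / 1000" using linear_coefficient_le c_cube_le by simp
  then have "exp (mean_overlap * (real d * \<beta>\<^sup>2 * real n)\<^sup>2) \<le> exp (1 / 1000)" by simp
  also have "\<dots> \<le> 1 + 1 / 1000 + (1 / 1000)\<^sup>2" by (rule exp_bound) auto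
  finally have linear: "exp (mean_overlap * (real d * \<beta>\<^sup>2 * real n)\<^sup>2) \<le> 1 + 1 / 1000 + (1 / 1000)\<^sup>2" .
  have "exp (9 :: real) = exp 1 ^ 9" by (simp flip: exp_of_nat_mult)
  also have "\<dots> \<le> 3 ^ 9" using exp_le by (intro power_mono) auto
  finally have "72 * (real d * \<beta>\<^sup>2 * mean_overlap) * exp 9 \<le> 72 * (4 * c) * 3 ^ 9"
    using c by (intro mult_mono mult_left_mono quadratic_coefficient_le) auto
  then have quadratic: "8 * (9 * real d * \<beta>\<^sup>2) * mean_overlap * exp 9 \<le> 6 / 1000" using c by (simp add: mult_ac)
  have "1 + 1 / 1000 + (1 / 1000)\<^sup>2 + 6 / 1000 \<le> (1 + 0.1\<^sup>2 :: real)" by (simp add: power2_eq_square)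
  with add_mono[OF linear quadratic] show ?thesis by (rule order_trans)
qed

end

lemma tv_dist_null_alt_le_tenth:
  assumes "nat \<lfloor>\<epsilon> * real n\<rfloor> = k"
  shows "\<exists>\<beta>\<ge>0. tv_dist (null_dist d n) (alt_dist d n \<epsilon> \<alpha> \<beta>) \<le> 0.1"
proof -
  obtain \<beta> where \<beta>: "\<beta> \<ge> 0" "\<beta> \<le> 2 * \<alpha>\<^sup>2 / (real d * \<epsilon>)"
    and match: "variance_matched (real k) (real (n - k)) (\<alpha>\<^sup>2 / real d) \<beta>"
    using ex_variance_matched_shift by blast
  have "mean_overlap * (real d * \<beta>\<^sup>2 * real n)\<^sup>2 \<le> 1" using linear_coefficient_le[OF \<beta>] c_cube_le by simp
  then have "tv_dist (null_dist d n) (alt_dist d n \<epsilon> \<alpha> \<beta>) \<le> 0.1"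
    by (intro tv_dist_null_alt_le[OF d_pos \<alpha>(1) assms two_k_le \<beta>(1) shift_times_n_le[OF \<beta>] match mean_overlap_def mean_overlap_ge_9 _
        quadratic_range_le[OF \<beta>] chi_square_le[OF \<beta>]]) auto
  with \<beta>(1) show ?thesis by blast
qed

end

theorem theorem6p1:
  shows "\<exists>c>0. \<forall>(d::nat) (n::nat) (\<epsilon>::real) (\<alpha>::real).
    d \<ge> 1 \<longrightarrow> 0 \<le> \<epsilon> \<longrightarrow> 0 < \<alpha> \<longrightarrow> \<epsilon> \<le> \<alpha> \<longrightarrow> \<alpha> \<le> 1 \<longrightarrow> \<epsilon> * real n \<in> \<int> \<longrightarrow>
    real n \<le> c * min (real d powr (2/3) * \<epsilon> powr (2/3) / \<alpha> powr (8/3)) (real d * \<epsilon> / \<alpha>\<^sup>2) \<longrightarrow>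
    real n \<ge> sqrt (real d) / \<alpha>\<^sup>2 + real d * \<epsilon> ^ 3 / \<alpha> ^ 4 \<longrightarrow>
    (\<exists>\<beta>\<ge>0. tv_dist (null_dist d n) (alt_dist d n \<epsilon> \<alpha> \<beta>) \<le> 0.1)"
proof (rule exI[of _ "1 / 10 ^ 9"], intro conjI allI impI)
  fix d n :: nat and \<epsilon> \<alpha> :: real
  assume "d \<ge> 1" "0 \<le> \<epsilon>" "0 < \<alpha>" "\<alpha> \<le> 1" "\<epsilon> * real n \<in> \<int>"
    and "real n \<le> 1 / 10 ^ 9 * min (real d powr (2/3) * \<epsilon> powr (2/3) / \<alpha> powr (8/3)) (real d * \<epsilon> / \<alpha>\<^sup>2)"
    and "real n \<ge> sqrt (real d) / \<alpha>\<^sup>2 + real d * \<epsilon> ^ 3 / \<alpha> ^ 4"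
  then interpret sparse_regime d n "nat \<lfloor>\<epsilon> * real n\<rfloor>" \<epsilon> \<alpha> "1 / 10 ^ 9"
    by (intro sparse_regimeI) auto
  show "\<exists>\<beta>\<ge>0. tv_dist (null_dist d n) (alt_dist d n \<epsilon> \<alpha> \<beta>) \<le> 0.1"
    by (rule tv_dist_null_alt_le_tenth) (rule refl)
qed simp

end
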